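(* Let $p$ be a prime and let $\mathcal F$ be a saturated fusion system on a finite $p$-group $S$. Then (1) $B(\mathcal F)^\times=\bigcap_{P\leq S}\mathrm{Ker}(d^{\mathcal F}_P)$; (2) $B(\mathcal F)^\times=\bigcap_{R}\mathrm{Ker}(d^{\mathcal F}_R)$, where $R$ runs over the subgroups of $S$ such that $R=S$ or $R$ is $\mathcal F$-essential.
   Context: Burnside rings: for a finite group $G$, $B(G)$ is the Grothendieck ring of finite left $G$-sets, with addition $[X]+[Y]=[X\sqcup Y]$ and multiplication $[X][Y]=[X\times Y]$. For $H\leq G$, the map $[X]\mapsto|X^H|$ extends to a ring morphism $B(G)\to\mathbb Z$, written $a\mapsto|a^H|$; the map $a\mapsto(|a^H|)_{H\leq G}$ is injective, so $B(G)^\times$ is a finite elementary abelian $2$-group, regarded as an $\mathbb F_2$-vector space. For $H\leq G$, $B(\mathrm{Res}^G_H):B(G)\to B(H)$ is the ring morphism restricting the action to $H$. Fusion systems: a fusion system $\mathcal F$ on a finite $p$-group $S$ is a category whose objects are the subgroups of $S$ and whose morphisms are injective group homomorphisms, such that for $P,Q\leq S$ one has $\mathrm{Hom}_S(P,Q)\subseteq\mathrm{Hom}_{\mathcal F}(P,Q)$ (where $\mathrm{Hom}_S(P,Q)$ is the set of homomorphisms given by conjugation by an element of $S$), and every $\varphi\in\mathrm{Hom}_{\mathcal F}(P,Q)$ is the composition of an isomorphism in $\mathcal F$ and an inclusion of subgroups. Subgroups $P,Q$ are $\mathcal F$-conjugate if they are isomorphic in $\mathcal F$. $\mathrm{Aut}_{\mathcal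 F}(P)=\mathrm{Hom}_{\mathcal F}(P,P)$, $\mathrm{Aut}_S(P)=\mathrm{Hom}_S(P,P)$, $\mathrm{Out}_{\mathcal F}(P)=\mathrm{Aut}_{\mathcal F}(P)/\mathrm{Inn}(P)$, $\mathrm{Out}_S(P)=\mathrm{Aut}_S(P)/\mathrm{Inn}(P)$. $P$ is fully $\mathcal F$-automized if $\mathrm{Aut}_S(P)\in\mathrm{Syl}_p(\mathrm{Aut}_{\mathcal F}(P))$, and receptive if every isomorphism $\varphi:Q\to P$ in $\mathcal F$ extends to a morphism in $\mathcal F$ defined on $N_\varphi=\{g\in N_S(Q):\varphi c_g\varphi^{-1}\in\mathrm{Aut}_S(P)\}$, where $c_g$ is conjugation by $g$. $\mathcal F$ is saturated if every subgroup of $S$ is $\mathcal F$-conjugate to one that is fully $\mathcal F$-automized and receptive. A subgroup $R$ is $\mathcal F$-essential if it is $\mathcal F$-centric ($C_S(Q)\leq Q$ for every $\mathcal F$-conjugate $Q$ of $R$), fully normalized ($|N_S(R)|\geq|N_S(Q)|$ for every $\mathcal F$-conjugate $Q$ of $R$), and $\mathrm{Out}_{\mathcal F}(R)$ has a strongly $p$-embedded subgroup (a proper subgroup $H$ with $p\mid|H|$ and $p\nmid|H\cap xHx^{-1}|$ for all $x\notin H$). The Burnside ring of $\mathcal F$ is the subring $B(\mathcal F)=\{a\in B(S): |a^P|=|a^Q|\text{ whenever }P,Q\leq S\text{ are }\mathcal F\text{-conjugate}\}$, with unit group $B(\mathcal F)^\times\leq B(S)^\times$. Outer action: $\mathrm{Aut}(P)$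 acts on $B(P)$ by ring automorphisms, where $\alpha\cdot[X]$ is the class of the $P$-set $X$ with action transported along $\alpha$ (i.e. $g$ acts as $\alpha^{-1}(g)$); equivalently $|(\alpha\cdot b)^Q|=|b^{\alpha^{-1}(Q)}|$ for $Q\leq P$. $\mathrm{Inn}(P)$ acts trivially, so $\mathrm{Out}(P)$ acts on $B(P)$ and on $B(P)^\times$; for $\Gamma\leq\mathrm{Out}(P)$, $(B(P)^\times)^\Gamma$ denotes the $\Gamma$-fixed points. The map $d^{\mathcal F}_P$: for $P\leq S$, the image of $B(\mathrm{Res}^S_P):B(S)^\times\to B(P)^\times$ lies in $(B(P)^\times)^{\mathrm{Out}_S(P)}$, and $d^{\mathcal F}_P:B(S)^\times\to(B(P)^\times)^{\mathrm{Out}_S(P)}/(B(P)^\times)^{\mathrm{Out}_{\mathcal F}(P)}$ is the $\mathbb F_2$-linear map given by restriction followed by the quotient map. *)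

theory Defs
  imports
    "HOL-Algebra.Group_Action" "HOL-Algebra.Ring"
    "HOL-Computational_Algebra.Primes" "HOL-Library.Nat_Bijection"
begin

section \<open>Finite G-sets\<close>

text \<open>
  A G-set is a pair \<open>(E, \<phi>)\<close> with \<open>group_action G E \<phi>\<close>; the values of \<open>\<phi>\<close> outside
  \<open>carrier G\<close> are irrelevant and do not affect anything below.  Every finite G-set is
  isomorphic to one whose points are natural numbers, so the Grothendieck construction only uses
  those; disjoint unions and products are formed on the sum and product types and then carried
  back to \<open>nat\<close> along \<open>sum_encode\<close> and \<open>prod_encode\<close>.
\<close>

type_synonym ('a, 'x) gset = "'x set \<times> ('a \<Rightarrow> 'x \<Rightarrow> 'x)"

definition finite_gsets :: "('a, 'm) monoid_scheme \<Rightarrow> ('a, 'x) gset set" where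
  "finite_gsets G = {(E, \<phi>). finite E \<and> group_action G E \<phi>}"

definition gset_iso :: "('a, 'm) monoid_scheme \<Rightarrow> ('a, 'x) gset \<Rightarrow> ('a, 'y) gset \<Rightarrow> bool" where
  "gset_iso G X Y \<longleftrightarrow>
     (\<exists>f. bij_betw f (fst X) (fst Y) \<and>
          (\<forall>g \<in> carrier G. \<forall>x \<in> fst X. f (snd X g x) = snd Y g (f x)))"

definition gset_image :: "('x \<Rightarrow> 'y) \<Rightarrow> ('a, 'x) gset \<Rightarrow> ('a, 'y) gset" where
  "gset_image f X = (f ` fst X, \<lambda>g. \<lambda>y \<in> f ` fst X. f (snd X g (inv_into (fst X) f y)))"

definition gset_sum :: "('a, 'x) gset \<Rightarrow> ('a, 'y) gset \<Rightarrow> ('a, 'x + 'y) gset" where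
  "gset_sum X Y =
     (fst X <+> fst Y,
      \<lambda>g. \<lambda>z \<in> fst X <+> fst Y. map_sum (snd X g) (snd Y g) z)"

definition gset_prod :: "('a, 'x) gset \<Rightarrow> ('a, 'y) gset \<Rightarrow> ('a, 'x \<times> 'y) gset" where
  "gset_prod X Y = (fst X \<times> fst Y, \<lambda>g. \<lambda>z \<in> fst X \<times> fst Y. map_prod (snd X g) (snd Y g) z)"

definition trivial_gset :: "'x set \<Rightarrow> ('a, 'x) gset" where
  "trivial_gset E = (E, \<lambda>g. \<lambda>x \<in> E. x)"

definition gset_fixed :: "('a, 'x) gset \<Rightarrow> 'a set \<Rightarrow> 'x set" where
  "gset_fixed X H = {x \<in> fst X. \<forall>h \<in> H. snd X h x = x}"

abbreviation nsum :: "('a, nat) gset \<Rightarrow> ('a, nat) gset \<Rightarrow> ('a, nat) gset" where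
  "nsum X Y \<equiv> gset_image sum_encode (gset_sum X Y)"

abbreviation nprod :: "('a, nat) gset \<Rightarrow> ('a, nat) gset \<Rightarrow> ('a, nat) gset" where
  "nprod X Y \<equiv> gset_image prod_encode (gset_prod X Y)"


section \<open>The Burnside ring\<close>

text \<open>
  A pair \<open>(X, Y)\<close> stands for the formal difference \<open>[X] - [Y]\<close>, and elements of the Burnside
  ring are equivalence classes of such pairs.  Operations on classes are defined through
  representatives by taking unions, in the manner of \<open>UN_equiv_class2\<close>.
\<close>

type_synonym 'a virtual_gset = "('a, nat) gset \<times> ('a, nat) gset"

definition burnside_rel ::
    "('a, 'm) monoid_scheme \<Rightarrow> ('a virtual_gset \<times> 'a virtual_gset) set" where
  "burnside_rel G =
     {((X, Y), (X', Y')).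
        X \<in> finite_gsets G \<and> Y \<in> finite_gsets G \<and> X' \<in> finite_gsets G \<and> Y' \<in> finite_gsets G \<and>
        (\<exists>Z \<in> finite_gsets G. gset_iso G (nsum (nsum X Y') Z) (nsum (nsum X' Y) Z))}"

definition burnside_ring :: "('a, 'm) monoid_scheme \<Rightarrow> 'a virtual_gset set ring" where
  "burnside_ring G =
     \<lparr> carrier = (finite_gsets G \<times> finite_gsets G) // burnside_rel G,
       monoid.mult = (\<lambda>a b. \<Union>(X, Y) \<in> a. \<Union>(X', Y') \<in> b.
         burnside_rel G `` {(nsum (nprod X X') (nprod Y Y'), nsum (nprod X Y') (nprod Y X'))}),
       one = burnside_rel G `` {(trivial_gset {0}, trivial_gset {})},
       zero = burnside_rel G `` {(trivial_gset {}, trivial_gset {})},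
       add = (\<lambda>a b. \<Union>(X, Y) \<in> a. \<Union>(X', Y') \<in> b.
         burnside_rel G `` {(nsum X X', nsum Y Y')}) \<rparr>"

definition mark :: "'a set \<Rightarrow> 'a virtual_gset set \<Rightarrow> int" where
  "mark H a =
     the_elem ((\<lambda>(X, Y). int (card (gset_fixed X H)) - int (card (gset_fixed Y H))) ` a)"

text \<open>
  Restricting the action to a subgroup \<open>H\<close> does not change the pair representing a G-set, only
  the group over which it is considered.
\<close>

definition burnside_res ::
    "('a, 'm) monoid_scheme \<Rightarrow> 'a set \<Rightarrow> 'a virtual_gset set \<Rightarrow> 'a virtual_gset set" where
  "burnside_res G H a = (\<Union>v \<in> a. burnside_rel (G\<lparr>carrier := H\<rparr>) `` {v})"


section \<open>Automorphisms and the outer action\<close>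

definition gset_twist ::
    "('a, 'm) monoid_scheme \<Rightarrow> ('a \<Rightarrow> 'a) \<Rightarrow> ('a, 'x) gset \<Rightarrow> ('a, 'x) gset" where
  "gset_twist G \<alpha> X = (fst X, \<lambda>g. snd X (inv_into (carrier G) \<alpha> g))"

definition burnside_aut ::
    "('a, 'm) monoid_scheme \<Rightarrow> ('a \<Rightarrow> 'a) \<Rightarrow> 'a virtual_gset set \<Rightarrow> 'a virtual_gset set" where
  "burnside_aut G \<alpha> a =
     (\<Union>(X, Y) \<in> a. burnside_rel G `` {(gset_twist G \<alpha> X, gset_twist G \<alpha> Y)})"

definition conjugation :: "('a, 'm) monoid_scheme \<Rightarrow> 'a \<Rightarrow> 'a \<Rightarrow> 'a" where
  "conjugation G g x = g \<otimes>\<^bsub>G\<^esub> x \<otimes>\<^bsub>G\<^esub> inv\<^bsub>G\<^esub> g"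

text \<open>Homomorphisms out of a subgroup \<open>P\<close> are extensional on \<open>P\<close>, as in \<open>BijGroup\<close>.\<close>

definition Hom_conj :: "('a, 'm) monoid_scheme \<Rightarrow> 'a set \<Rightarrow> 'a set \<Rightarrow> ('a \<Rightarrow> 'a) set" where
  "Hom_conj S P Q =
     {restrict (conjugation S g) P | g. g \<in> carrier S \<and> conjugation S g ` P \<subseteq> Q}"

definition Inn :: "('a, 'm) monoid_scheme \<Rightarrow> ('a \<Rightarrow> 'a) set" where
  "Inn G = {restrict (conjugation G g) (carrier G) | g. g \<in> carrier G}"

definition Out_of ::
    "('a, 'm) monoid_scheme \<Rightarrow> ('a \<Rightarrow> 'a) set \<Rightarrow> ('a \<Rightarrow> 'a) set monoid" where
  "Out_of G A = (AutoGroup G)\<lparr>carrier := A\<rparr> Mod Inn G"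

text \<open>
  An element of \<open>Out(G)\<close> is a coset of \<open>Inn G\<close>; it acts through any of its members, which all
  act alike because \<open>Inn G\<close> acts trivially.
\<close>

definition burnside_out ::
    "('a, 'm) monoid_scheme \<Rightarrow> ('a \<Rightarrow> 'a) set \<Rightarrow> 'a virtual_gset set \<Rightarrow> 'a virtual_gset set" where
  "burnside_out G \<gamma> a = the_elem ((\<lambda>\<alpha>. burnside_aut G \<alpha> a) ` \<gamma>)"

definition fixed_units ::
    "('a, 'm) monoid_scheme \<Rightarrow> ('a \<Rightarrow> 'a) set set \<Rightarrow> 'a virtual_gset set set" where
  "fixed_units G \<Gamma> = {u \<in> Units (burnside_ring G). \<forall>\<gamma> \<in> \<Gamma>. burnside_out G \<gamma> u = u}"


section \<open>Fusion systems\<close>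

text \<open>
  A fusion system is given by its morphism sets \<open>F P Q\<close>; only their values at
  subgroups of \<open>S\<close> matter.
\<close>

type_synonym 'a fusion = "'a set \<Rightarrow> 'a set \<Rightarrow> ('a \<Rightarrow> 'a) set"

definition Iso_fus :: "'a fusion \<Rightarrow> 'a set \<Rightarrow> 'a set \<Rightarrow> ('a \<Rightarrow> 'a) set" where
  "Iso_fus F P Q =
     {f \<in> F P Q. \<exists>h \<in> F Q P. compose P h f = (\<lambda>x \<in> P. x) \<and> compose Q f h = (\<lambda>y \<in> Q. y)}"

definition fus_conj :: "'a fusion \<Rightarrow> 'a set \<Rightarrow> 'a set \<Rightarrow> bool" where
  "fus_conj F P Q \<longleftrightarrow> Iso_fus F P Q \<noteq> {}"

locale fusion_system = group S
  for p :: nat and S (structure) and F :: "'a fusion" +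
  assumes prime_p: "prime p"
    and finite_S: "finite (carrier S)"
    and p_group: "\<exists>n. order S = p ^ n"
    and F_sub: "\<lbrakk>subgroup P S; subgroup Q S; f \<in> F P Q\<rbrakk> \<Longrightarrow>
      f \<in> hom (S\<lparr>carrier := P\<rparr>) (S\<lparr>carrier := Q\<rparr>) \<and> f \<in> extensional P \<and> inj_on f P"
    and F_id: "subgroup P S \<Longrightarrow> (\<lambda>x \<in> P. x) \<in> F P P"
    and F_comp: "\<lbrakk>subgroup P S; subgroup Q S; subgroup R S; f \<in> F P Q; h \<in> F Q R\<rbrakk> \<Longrightarrow>
      compose P h f \<in> F P R"
    and F_conj: "\<lbrakk>subgroup P S; subgroup Q S\<rbrakk> \<Longrightarrow> Hom_conj S P Q \<subseteq> F P Q"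
    and F_factor: "\<lbrakk>subgroup P S; subgroup Q S; f \<in> F P Q\<rbrakk> \<Longrightarrow>
      \<exists>R h. subgroup R S \<and> R \<subseteq> Q \<and> h \<in> Iso_fus F P R \<and> f = compose P (\<lambda>x \<in> R. x) h"

definition Aut_fus :: "('a, 'm) monoid_scheme \<Rightarrow> 'a fusion \<Rightarrow> 'a set \<Rightarrow> ('a \<Rightarrow> 'a) monoid" where
  "Aut_fus S F P = (AutoGroup (S\<lparr>carrier := P\<rparr>))\<lparr>carrier := F P P\<rparr>"

definition Out_fus ::
    "('a, 'm) monoid_scheme \<Rightarrow> 'a fusion \<Rightarrow> 'a set \<Rightarrow> ('a \<Rightarrow> 'a) set monoid" where
  "Out_fus S F P = Out_of (S\<lparr>carrier := P\<rparr>) (F P P)"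

text \<open>\<open>Out\<^sub>S(P)\<close> is the instance \<open>Out_fus S (Hom_conj S) P\<close>.\<close>

definition Sylow_subgroup :: "nat \<Rightarrow> ('a, 'm) monoid_scheme \<Rightarrow> 'a set \<Rightarrow> bool" where
  "Sylow_subgroup p G H \<longleftrightarrow> subgroup H G \<and> card H = p ^ multiplicity p (order G)"

definition fully_automized ::
    "nat \<Rightarrow> ('a, 'm) monoid_scheme \<Rightarrow> 'a fusion \<Rightarrow> 'a set \<Rightarrow> bool" where
  "fully_automized p S F P \<longleftrightarrow> Sylow_subgroup p (Aut_fus S F P) (Hom_conj S P P)"

definition N_ext ::
    "('a, 'm) monoid_scheme \<Rightarrow> 'a set \<Rightarrow> 'a set \<Rightarrow> ('a \<Rightarrow> 'a) \<Rightarrow> 'a set" where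
  "N_ext S Q P f =
     {g \<in> normalizer S Q.
        (\<lambda>x \<in> P. f (conjugation S g (inv_into Q f x))) \<in> Hom_conj S P P}"

definition receptive :: "('a, 'm) monoid_scheme \<Rightarrow> 'a fusion \<Rightarrow> 'a set \<Rightarrow> bool" where
  "receptive S F P \<longleftrightarrow>
     (\<forall>Q f. subgroup Q S \<and> f \<in> Iso_fus F Q P \<longrightarrow>
        (\<exists>h \<in> F (N_ext S Q P f) (carrier S). \<forall>x \<in> Q. h x = f x))"

locale saturated_fusion_system = fusion_system +
  assumes saturated: "subgroup P S \<Longrightarrow>
    \<exists>Q. subgroup Q S \<and> fus_conj F P Q \<and> fully_automized p S F Q \<and> receptive S F Q"

definition centralizer :: "('a, 'm) monoid_scheme \<Rightarrow> 'a set \<Rightarrow> 'a set" where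
  "centralizer G H = {g \<in> carrier G. \<forall>h \<in> H. g \<otimes>\<^bsub>G\<^esub> h = h \<otimes>\<^bsub>G\<^esub> g}"

definition fus_centric :: "('a, 'm) monoid_scheme \<Rightarrow> 'a fusion \<Rightarrow> 'a set \<Rightarrow> bool" where
  "fus_centric S F R \<longleftrightarrow>
     (\<forall>Q. subgroup Q S \<and> fus_conj F R Q \<longrightarrow> centralizer S Q \<subseteq> Q)"

definition fully_normalized :: "('a, 'm) monoid_scheme \<Rightarrow> 'a fusion \<Rightarrow> 'a set \<Rightarrow> bool" where
  "fully_normalized S F R \<longleftrightarrow>
     (\<forall>Q. subgroup Q S \<and> fus_conj F R Q \<longrightarrow> card (normalizer S R) \<ge> card (normalizer S Q))"

definition strongly_embedded :: "nat \<Rightarrow> ('a, 'm) monoid_scheme \<Rightarrow> 'a set \<Rightarrow> bool" where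
  "strongly_embedded p G H \<longleftrightarrow>
     subgroup H G \<and> H \<noteq> carrier G \<and> p dvd card H \<and>
     (\<forall>x \<in> carrier G - H. \<not> p dvd card (H \<inter> conjugation G x ` H))"

definition essential :: "nat \<Rightarrow> ('a, 'm) monoid_scheme \<Rightarrow> 'a fusion \<Rightarrow> 'a set \<Rightarrow> bool" where
  "essential p S F R \<longleftrightarrow>
     subgroup R S \<and> fus_centric S F R \<and> fully_normalized S F R \<and>
     (\<exists>H. strongly_embedded p (Out_fus S F R) H)"


section \<open>The Burnside ring of a fusion system and the maps \<open>d\<close>\<close>

definition burnside_ring_fus ::
    "('a, 'm) monoid_scheme \<Rightarrow> 'a fusion \<Rightarrow> 'a virtual_gset set ring" where
  "burnside_ring_fus S F = (burnside_ring S)\<lparr>carrier :=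
     {a \<in> carrier (burnside_ring S).
        \<forall>P Q. subgroup P S \<and> subgroup Q S \<and> fus_conj F P Q \<longrightarrow> mark P a = mark Q a}\<rparr>"

definition d_source :: "('a, 'm) monoid_scheme \<Rightarrow> 'a virtual_gset set monoid" where
  "d_source S = units_of (burnside_ring S)"

definition d_target ::
    "('a, 'm) monoid_scheme \<Rightarrow> 'a fusion \<Rightarrow> 'a set \<Rightarrow> 'a virtual_gset set set monoid" where
  "d_target S F P =
     (let U = units_of (burnside_ring (S\<lparr>carrier := P\<rparr>));
          fixed = (\<lambda>E. fixed_units (S\<lparr>carrier := P\<rparr>) (carrier (Out_fus S E P)))
      in U\<lparr>carrier := fixed (Hom_conj S)\<rparr> Mod fixed F)"

definition d_map ::
    "('a, 'm) monoid_scheme \<Rightarrow> 'a fusion \<Rightarrow> 'a set \<Rightarrow>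
       'a virtual_gset set \<Rightarrow> 'a virtual_gset set set" where
  "d_map S F P u =
     fixed_units (S\<lparr>carrier := P\<rparr>) (carrier (Out_fus S F P))
       #>\<^bsub>units_of (burnside_ring (S\<lparr>carrier := P\<rparr>))\<^esub> burnside_res S P u"

abbreviation ker_d ::
    "('a, 'm) monoid_scheme \<Rightarrow> 'a fusion \<Rightarrow> 'a set \<Rightarrow> 'a virtual_gset set set" where
  "ker_d S F P \<equiv> kernel (d_source S) (d_target S F P) (d_map S F P)"

end

theory Submission
  imports Defs "HOL-Algebra.Sylow"
begin

text \<open>
  Finite G-sets with the same numbers of fixed points are isomorphic, so an element of the Burnside
  ring is determined by its marks, and the units are the elements whose marks are all \<open>\<plusminus>1\<close>.  In
  terms of marks, a unit \<open>u\<close> lies in the kernel of \<open>d\<^sub>P\<close> iff \<open>|u\<^sup>A|\<close> does not change when a subgroup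
  \<open>A\<close> of \<open>P\<close> is moved by an \<open>F\<close>-automorphism of \<open>P\<close>.  By the Alperin--Goldschmidt fusion theorem,
  every \<open>F\<close>-isomorphism is a composite of restrictions of \<open>F\<close>-automorphisms of \<open>S\<close> and of essential
  subgroups, so invariance under those already makes \<open>u\<close> constant on \<open>F\<close>-conjugacy classes.
\<close>

section \<open>Finite G-sets and their fixed points\<close>

text \<open>The strongly embedded subgroup that makes \<open>R\<close> essential is not searched for
  among \<open>p\<close>-subgroups: it is the image of the automorphisms of \<open>R\<close> that
  preserve the given function on subgroups. Downward induction on order settles every morphism that
  extends to a larger subgroup, and receptivity turns extension of an automorphism of
  \<open>R\<close> into a condition on one element: it has to conjugate some member of Aut_S(R)
  outside Inn(R) into Aut_S(R). Such members exist because \<open>R\<close> is smaller than its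
  normalizer and contains its centralizer; if it does not contain its centralizer, every
  automorphism extends anyway. Receptivity and full automization are available only for some
  conjugate of a given subgroup, so an arbitrary isomorphism is compared with an automorphism of
  that conjugate. On the side of rings, the outer action and the quotients in \<open>d\<close> are
  defined on classes. Since marks are multiplicative and injective, and a unit is its own inverse,
  the laws and kernels needed for units reduce to equalities of integers.\<close>

text \<open>
  Unlike \<open>group_action\<close>, this does not ask for extensional maps, so that a sub-G-set keeps the
  same action function.
\<close>

definition finite_action :: "('a, 'm) monoid_scheme \<Rightarrow> ('a, 'x) gset \<Rightarrow> bool" where
  "finite_action G X \<longleftrightarrow> finite (fst X) \<and>
     (\<forall>g \<in> carrier G. \<forall>x \<in> fst X. snd X g x \<in> fst X) \<and>
     (\<forall>x \<in> fst X. snd X \<one>\<^bsub>G\<^esub> x = x) \<and>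
     (\<forall>g \<in> carrier G. \<forall>h \<in> carrier G. \<forall>x \<in> fst X.
        snd X (g \<otimes>\<^bsub>G\<^esub> h) x = snd X g (snd X h x))"

text \<open>The inverse of \<open>g\<close> supplies the inverse bijection, and extensionality is
  what \<open>Bij\<close> asks for beyond an action. This is the way back from
  \<open>finite_action\<close> to \<open>finite_gsets\<close>.\<close>

lemma finite_action_gsets:
  fixes G (structure)
  assumes "group G" "finite_action G X"
    and ext: "\<And>g. g \<in> carrier G \<Longrightarrow> snd X g \<in> extensional (fst X)"
  shows "X \<in> finite_gsets G"
proof -
  interpret group G by fact
  obtain E \<phi> where X: "X = (E, \<phi>)" by (cases X)
  have act: "finite E" "\<And>g x. g \<in> carrier G \<Longrightarrow> x \<in> E \<Longrightarrow> \<phi> g x \<in> E" "\<And>x. x \<in> E \<Longrightarrow> \<phi> \<one> x = x"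
    "\<And>g h x. g \<in> carrier G \<Longrightarrow> h \<in> carrier G \<Longrightarrow> x \<in> E \<Longrightarrow> \<phi> (g \<otimes> h) x = \<phi> g (\<phi> h x)"
    using assms(2) by (auto simp: finite_action_def X)
  have bij: "\<phi> g \<in> Bij E" if "g \<in> carrier G" for g
  proof -
    have "bij_betw (\<phi> g) E E"
      by (rule bij_betw_byWitness[where f' = "\<phi> (inv g)"])
        (use that act(2) in \<open>auto simp: act(3) simp flip: act(4)\<close>)
    then show ?thesis using ext[OF that] by (simp add: Bij_def X)
  qed
  have "\<phi> (g \<otimes> h) = compose E (\<phi> g) (\<phi> h)" if "g \<in> carrier G" "h \<in> carrier G" for g h
    by (rule extensionalityI[where A = E])
      (use that act ext[of "g \<otimes> h"] in \<open>auto simp: X compose_eq\<close>)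
  then have "\<phi> \<in> hom G (BijGroup E)"
    using bij by (auto simp: hom_def BijGroup_def)
  then show ?thesis
    using act(1)
    by (simp add: X finite_gsets_def group_action_def group_hom_def group_hom_axioms_def
        group_BijGroup is_group)
qed

lemma finite_gsetsD:
  fixes G (structure)
  assumes "X \<in> finite_gsets G"
  shows "finite_action G X" "g \<in> carrier G \<Longrightarrow> snd X g \<in> extensional (fst X)"
proof -
  obtain E \<phi> where X: "X = (E, \<phi>)" by (cases X)
  interpret group_action G E \<phi> using assms by (simp add: X finite_gsets_def)
  show "finite_action G X"
    using assms composition_rule
    by (auto simp: X finite_gsets_def finite_action_def simp flip: id_eq_one
        intro: element_image)
  show "g \<in> carrier G \<Longrightarrow> snd X g \<in> extensional (fst X)"
    using bij_prop0 by (simp add: X Bij_def)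
qed

text \<open>An equivariant injection reflects fixed points as well as preserving them, so it
  restricts to a bijection of the fixed points.\<close>

lemma gset_iso_fixed:
  assumes "gset_iso G X Y" "H \<subseteq> carrier G" "finite_action G X"
  shows "card (gset_fixed X H) = card (gset_fixed Y H)"
proof -
  obtain f where f: "bij_betw f (fst X) (fst Y)"
    "\<And>g x. g \<in> carrier G \<Longrightarrow> x \<in> fst X \<Longrightarrow> f (snd X g x) = snd Y g (f x)"
    using assms(1) by (auto simp: gset_iso_def)
  have "snd X h x = x \<longleftrightarrow> snd Y h (f x) = f x" if "h \<in> H" "x \<in> fst X" for h x
  proof -
    have "snd X h x \<in> fst X" using that assms by (auto simp: finite_action_def)
    then have "snd X h x = x \<longleftrightarrow> f (snd X h x) = f x"
      using f(1) that by (auto simp: bij_betw_def inj_on_def)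
    then show ?thesis using f(2)[of h x] that assms(2) by auto
  qed
  note * = this
  have "f ` gset_fixed X H = gset_fixed Y H"
  proof (intro equalityI subsetI)
    fix y assume y: "y \<in> gset_fixed Y H"
    then obtain x where "x \<in> fst X" "y = f x"
      using f(1) by (auto simp: gset_fixed_def bij_betw_def)
    then show "y \<in> f ` gset_fixed X H" using y * by (auto simp: gset_fixed_def)
  qed (use f(1) * in \<open>auto simp: gset_fixed_def bij_betw_def\<close>)
  then have "bij_betw f (gset_fixed X H) (gset_fixed Y H)"
    using f(1) by (auto simp: bij_betw_def gset_fixed_def intro: inj_on_subset)
  then show ?thesis by (rule bij_betw_same_card)
qed

section \<open>Orbits and stabilizers\<close>

context group
begin

abbreviation gset_stab :: "('a, 'x) gset \<Rightarrow> 'x \<Rightarrow> 'a set" where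
  "gset_stab X x \<equiv> stabilizer G (snd X) x"

abbreviation gset_orb :: "('a, 'x) gset \<Rightarrow> 'x \<Rightarrow> 'x set" where
  "gset_orb X x \<equiv> orbit G (snd X) x"

lemma gset_stab_subgroup:
  assumes "finite_action G X" "x \<in> fst X"
  shows "subgroup (gset_stab X x) G"
proof (rule subgroupI)
  show "gset_stab X x \<subseteq> carrier G" by (auto simp: stabilizer_def)
  show "gset_stab X x \<noteq> {}"
    using assms by (auto simp: stabilizer_def finite_action_def)
next
  fix a assume a: "a \<in> gset_stab X x"
  then have aG: "a \<in> carrier G" "snd X a x = x" by (auto simp: stabilizer_def)
  have "snd X (inv a \<otimes> a) x = snd X (inv a) (snd X a x)"
    using assms aG(1) unfolding finite_action_def by blast
  then have "snd X (inv a) x = x"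
    using aG assms by (simp add: finite_action_def)
  then show "inv a \<in> gset_stab X x"
    using aG by (auto simp: stabilizer_def)
next
  fix a b assume "a \<in> gset_stab X x" "b \<in> gset_stab X x"
  then show "a \<otimes> b \<in> gset_stab X x"
    using assms by (auto simp: stabilizer_def finite_action_def)
qed

text \<open>The equivalence makes both the orbit and its complement invariant, so that splitting off
  an orbit leaves a G-set.\<close>

lemma gset_orb_closed:
  assumes "finite_action G X" "x \<in> fst X" "g \<in> carrier G"
  shows "z \<in> fst X \<Longrightarrow> snd X g z \<in> gset_orb X x \<longleftrightarrow> z \<in> gset_orb X x"
    and "x \<in> gset_orb X x" "gset_orb X x \<subseteq> fst X"
proof -
  have act: "snd X (g \<otimes> h) z = snd X g (snd X h z)"
    if "g \<in> carrier G" "h \<in> carrier G" "z \<in> fst X" for g h z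
    using that assms(1) by (auto simp: finite_action_def)
  have one: "snd X \<one> z = z" if "z \<in> fst X" for z
    using that assms(1) by (auto simp: finite_action_def)
  have step: "snd X h z \<in> gset_orb X x" if "z \<in> gset_orb X x" "h \<in> carrier G" for h z
    using that assms(2) act by (auto simp: orbit_def) (metis m_closed)
  show "snd X g z \<in> gset_orb X x \<longleftrightarrow> z \<in> gset_orb X x" if z: "z \<in> fst X"
  proof
    assume "snd X g z \<in> gset_orb X x"
    from step[OF this, of "inv g"] show "z \<in> gset_orb X x"
      using assms(3) z by (simp add: one flip: act)
  qed (use step assms in auto)
  show "x \<in> gset_orb X x" using one[OF assms(2)] by (force simp: orbit_def)
  show "gset_orb X x \<subseteq> fst X" using assms by (auto simp: orbit_def finite_action_def)
qed

text \<open>The points \<open>g x\<close> and \<open>h x\<close> coincide iff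
  \<open>inv g \<otimes> h\<close> stabilizes \<open>x\<close>. Equal stabilizers therefore make the
  map from \<open>g x\<close> to \<open>g y\<close> well defined and injective at once.\<close>

lemma gset_iso_orbits:
  assumes X: "finite_action G X" "x \<in> fst X" and Y: "finite_action G Y" "y \<in> fst Y"
    and stab: "gset_stab X x = gset_stab Y y"
  shows "gset_iso G (gset_orb X x, snd X) (gset_orb Y y, snd Y)"
proof -
  have actX: "snd X (g \<otimes> h) z = snd X g (snd X h z)" "snd X \<one> z = z" "snd X g z \<in> fst X"
    if "g \<in> carrier G" "h \<in> carrier G" "z \<in> fst X" for g h z
    using that assms(1) by (auto simp: finite_action_def)
  have actY: "snd Y (g \<otimes> h) z = snd Y g (snd Y h z)" "snd Y \<one> z = z" "snd Y g z \<in> fst Y"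
    if "g \<in> carrier G" "h \<in> carrier G" "z \<in> fst Y" for g h z
    using that assms(3) by (auto simp: finite_action_def)
  have eqX: "snd X g x = snd X h x \<longleftrightarrow> inv g \<otimes> h \<in> gset_stab X x"
    if "g \<in> carrier G" "h \<in> carrier G" for g h
  proof -
    have "snd X g x = snd X h x" if "snd X (inv g) (snd X h x) = x"
      using arg_cong[OF that, of "snd X g"] \<open>g \<in> _\<close> \<open>h \<in> _\<close> X(2)
      by (simp add: actX flip: actX(1) m_assoc)
    moreover have "snd X (inv g) (snd X h x) = x" if "snd X g x = snd X h x"
      using \<open>g \<in> _\<close> \<open>h \<in> _\<close> X(2) by (simp add: actX flip: that actX(1))
    ultimately show ?thesis using that X(2) by (auto simp: stabilizer_def actX)
  qed
  have eqY: "snd Y g y = snd Y h y \<longleftrightarrow> inv g \<otimes> h \<in> gset_stab Y y"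
    if "g \<in> carrier G" "h \<in> carrier G" for g h
  proof -
    have "snd Y g y = snd Y h y" if "snd Y (inv g) (snd Y h y) = y"
      using arg_cong[OF that, of "snd Y g"] \<open>g \<in> _\<close> \<open>h \<in> _\<close> Y(2)
      by (simp add: actY flip: actY(1) m_assoc)
    moreover have "snd Y (inv g) (snd Y h y) = y" if "snd Y g y = snd Y h y"
      using \<open>g \<in> _\<close> \<open>h \<in> _\<close> Y(2) by (simp add: actY flip: that actY(1))
    ultimately show ?thesis using that Y(2) by (auto simp: stabilizer_def actY)
  qed
  have eq: "snd X g x = snd X h x \<longleftrightarrow> snd Y g y = snd Y h y"
    if "g \<in> carrier G" "h \<in> carrier G" for g h
    using eqX[OF that] eqY[OF that] stab by simp
  \<comment> \<open>\<open>r z\<close> is any element carrying \<open>x\<close> to \<open>z\<close>;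
    by \<open>eq\<close> the point \<open>snd Y (r z) y\<close> does not depend on the
    choice.\<close>
  define r where "r z = (SOME g. g \<in> carrier G \<and> snd X g x = z)" for z
  define f where "f z = snd Y (r z) y" for z
  have f: "f (snd X g x) = snd Y g y" if "g \<in> carrier G" for g
  proof -
    have "r (snd X g x) \<in> carrier G \<and> snd X (r (snd X g x)) x = snd X g x"
      unfolding r_def by (rule someI[of _ g]) (use that in simp)
    then show ?thesis using eq[of "r (snd X g x)" g] that by (simp add: f_def)
  qed
  have "bij_betw f (gset_orb X x) (gset_orb Y y)"
    unfolding bij_betw_def
  proof
    show "inj_on f (gset_orb X x)"
      by (rule inj_onI) (auto simp: orbit_def f eq)
    show "f ` gset_orb X x = gset_orb Y y"
      by (force simp: orbit_def f image_iff)
  qed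
  moreover have "f (snd X g z) = snd Y g (f z)" if "g \<in> carrier G" "z \<in> gset_orb X x" for g z
    using that X(2) Y(2) by (auto simp: orbit_def f simp flip: actX(1) actY(1))
  ultimately show ?thesis by (auto simp: gset_iso_def)
qed

text \<open>
  Induction on the number of points: a stabilizer \<open>H\<close> of maximal order in \<open>X\<close> is also the
  stabilizer of every \<open>H\<close>-fixed point of \<open>Y\<close>, so \<open>X\<close> and \<open>Y\<close> have a common orbit type
  which can be split off.
\<close>

theorem gset_iso_of_fixed:
  assumes "finite (carrier G)" "finite_action G X" "finite_action G Y"
    and "\<And>H. subgroup H G \<Longrightarrow> card (gset_fixed X H) = card (gset_fixed Y H)"
  shows "gset_iso G X Y"
  using assms(2-4)
proof (induction "card (fst X)" arbitrary: X Y rule: less_induct)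
  case less
  note X = less.prems(1) and Y = less.prems(2) and marks = less.prems(3)
  have fin: "finite (fst X)" "finite (fst Y)" using X Y by (auto simp: finite_action_def)
  have ne: "gset_fixed X H \<noteq> {} \<longleftrightarrow> gset_fixed Y H \<noteq> {}" if "subgroup H G" for H
  proof -
    have "finite (gset_fixed X H)" "finite (gset_fixed Y H)"
      using fin by (auto simp: gset_fixed_def)
    then show ?thesis using marks[OF that] by (metis card_0_eq)
  qed
  have triv: "gset_fixed X {\<one>} = fst X" "gset_fixed Y {\<one>} = fst Y"
    using X Y by (auto simp: gset_fixed_def finite_action_def)
  show ?case
  proof (cases "fst X = {}")
    case True
    then have "fst Y = {}" using ne[OF triv_subgroup] triv by auto
    with True show ?thesis by (auto simp: gset_iso_def bij_betw_def)
  next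
    case False
    have "finite ((\<lambda>x. card (gset_stab X x)) ` fst X)" using fin by simp
    then have "Max ((\<lambda>x. card (gset_stab X x)) ` fst X) \<in> (\<lambda>x. card (gset_stab X x)) ` fst X"
      using False by (intro Max_in) auto
    then obtain x where x: "x \<in> fst X"
      and maxeq: "card (gset_stab X x) = Max ((\<lambda>x. card (gset_stab X x)) ` fst X)"
      by auto
    have max: "card (gset_stab X x') \<le> card (gset_stab X x)" if "x' \<in> fst X" for x'
      using that fin by (simp add: maxeq)
    let ?H = "gset_stab X x"
    have H: "subgroup ?H G" by (rule gset_stab_subgroup[OF X x])
    have "x \<in> gset_fixed X ?H" using x by (auto simp: gset_fixed_def stabilizer_def)
    then obtain y where y: "y \<in> gset_fixed Y ?H" using ne[OF H] by auto
    then have yY: "y \<in> fst Y" by (simp add: gset_fixed_def)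
    let ?K = "gset_stab Y y"
    have K: "subgroup ?K G" by (rule gset_stab_subgroup[OF Y yY])
    have HK: "?H \<subseteq> ?K" using y by (auto simp: gset_fixed_def stabilizer_def)
    \<comment> \<open>Fixed points are now compared in the other direction: some point of
      \<open>X\<close> is fixed by \<open>?K\<close>, and maximality of \<open>?H\<close> bounds
      \<open>card ?K\<close>.\<close>
    have "y \<in> gset_fixed Y ?K" using yY by (auto simp: gset_fixed_def stabilizer_def)
    then obtain x' where x': "x' \<in> gset_fixed X ?K" using ne[OF K] by auto
    then have "?K \<subseteq> gset_stab X x'"
      by (auto simp: gset_fixed_def stabilizer_def)
    moreover have finG: "finite (gset_stab Y z)" for z
      using assms(1) by (simp add: stabilizer_def)
    moreover have "finite (gset_stab X x')"
      using assms(1) by (simp add: stabilizer_def)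
    moreover have "x' \<in> fst X" using x' by (simp add: gset_fixed_def)
    ultimately have "card ?K \<le> card ?H"
      using max[of x'] card_mono[of "gset_stab X x'" ?K] by linarith
    then have HKeq: "?H = ?K" using card_seteq[OF finG HK] by simp
    note orbX = gset_orb_closed[OF X x] and orbY = gset_orb_closed[OF Y yY]
    obtain f where f: "bij_betw f (gset_orb X x) (gset_orb Y y)"
      "\<And>g z. g \<in> carrier G \<Longrightarrow> z \<in> gset_orb X x \<Longrightarrow> f (snd X g z) = snd Y g (f z)"
      using gset_iso_orbits[OF X x Y yY HKeq] by (auto simp: gset_iso_def)
    define X' where "X' = (fst X - gset_orb X x, snd X)"
    define Y' where "Y' = (fst Y - gset_orb Y y, snd Y)"
    have actX': "finite_action G X'"
      using X orbX(1) by (auto simp: finite_action_def X'_def)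
    have actY': "finite_action G Y'"
      using Y orbY(1) by (auto simp: finite_action_def Y'_def)
    have actO: "finite_action G (gset_orb X x, snd X)"
      using X orbX(1) orbX(3)[OF one_closed]
      by (auto simp: finite_action_def subset_iff intro: finite_subset)
    \<comment> \<open>The two removed orbits are isomorphic, so the same number of fixed points is
      subtracted on both sides.\<close>
    have "card (gset_fixed X' K) = card (gset_fixed Y' K)" if "subgroup K G" for K
    proof -
      have "gset_fixed X' K = gset_fixed X K - gset_fixed (gset_orb X x, snd X) K"
        "gset_fixed Y' K = gset_fixed Y K - gset_fixed (gset_orb Y y, snd Y) K"
        by (auto simp: gset_fixed_def X'_def Y'_def)
      moreover have "gset_fixed (gset_orb X x, snd X) K \<subseteq> gset_fixed X K"
        "gset_fixed (gset_orb Y y, snd Y) K \<subseteq> gset_fixed Y K"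
        using orbX(3)[OF one_closed] orbY(3)[OF one_closed] by (auto simp: gset_fixed_def)
      moreover have "card (gset_fixed (gset_orb X x, snd X) K)
          = card (gset_fixed (gset_orb Y y, snd Y) K)"
        by (rule gset_iso_fixed[OF gset_iso_orbits[OF X x Y yY HKeq] _ actO])
          (rule subgroup.subset[OF that])
      moreover have "finite (gset_fixed X K)" "finite (gset_fixed Y K)"
        using fin by (auto simp: gset_fixed_def)
      ultimately show ?thesis using marks[OF that]
        by (simp add: card_Diff_subset finite_subset)
    qed
    moreover have "card (fst X') < card (fst X)"
      using fin(1) orbX(2)[OF one_closed] x by (auto simp: X'_def intro!: psubset_card_mono)
    ultimately have "gset_iso G X' Y'" using less.hyps actX' actY' by blast
    then obtain f' where f': "bij_betw f' (fst X - gset_orb X x) (fst Y - gset_orb Y y)"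
      "\<And>g z. g \<in> carrier G \<Longrightarrow> z \<in> fst X - gset_orb X x \<Longrightarrow> f' (snd X g z) = snd Y g (f' z)"
      by (auto simp: gset_iso_def X'_def Y'_def)
    let ?f = "\<lambda>z. if z \<in> gset_orb X x then f z else f' z"
    have "bij_betw ?f (gset_orb X x \<union> (fst X - gset_orb X x))
        (gset_orb Y y \<union> (fst Y - gset_orb Y y))"
    proof (rule bij_betw_combine)
      show "bij_betw ?f (gset_orb X x) (gset_orb Y y)"
        using f(1) by (subst bij_betw_cong[where g = f]) auto
      show "bij_betw ?f (fst X - gset_orb X x) (fst Y - gset_orb Y y)"
        using f'(1) by (subst bij_betw_cong[where g = f']) auto
    qed auto
    moreover have "gset_orb X x \<union> (fst X - gset_orb X x) = fst X"
      "gset_orb Y y \<union> (fst Y - gset_orb Y y) = fst Y"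
      using orbX(3)[OF one_closed] orbY(3)[OF one_closed] by auto
    ultimately have "bij_betw ?f (fst X) (fst Y)" by simp
    moreover have "?f (snd X g z) = snd Y g (?f z)" if "g \<in> carrier G" "z \<in> fst X" for g z
      using that orbX(1)[OF that] f(2) f'(2) by auto
    ultimately show ?thesis by (auto simp: gset_iso_def)
  qed
qed

end

section \<open>Transport, sums and products of G-sets\<close>

lemma gset_image_finite:
  assumes G: "group G" and X: "finite_action G X" and f: "inj_on f (fst X)"
  shows "gset_image f X \<in> finite_gsets G"
    and "subgroup H G \<Longrightarrow> card (gset_fixed (gset_image f X) H) = card (gset_fixed X H)"
proof -
  have eq: "snd (gset_image f X) g (f x) = f (snd X g x)" if "x \<in> fst X" for g x
    using that f by (simp add: gset_image_def)
  have fst: "fst (gset_image f X) = f ` fst X" by (simp add: gset_image_def)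
  have act: "finite_action G (gset_image f X)"
    using X monoid.m_closed[OF group.is_monoid[OF G]]
    by (auto simp: finite_action_def fst eq)
  then show "gset_image f X \<in> finite_gsets G"
    by (rule finite_action_gsets[OF G]) (simp add: gset_image_def)
  have "gset_iso G X (gset_image f X)"
    unfolding gset_iso_def
    by (rule exI[of _ f]) (use f in \<open>auto simp: fst eq bij_betw_def\<close>)
  then show "card (gset_fixed (gset_image f X) H) = card (gset_fixed X H)" if "subgroup H G"
    using gset_iso_fixed[OF _ subgroup.subset[OF that] X] by metis
qed

lemma gset_sum_finite:
  assumes "group G" "finite_action G X" "finite_action G Y"
  shows "finite_action G (gset_sum X Y)"
    and "card (gset_fixed (gset_sum X Y) H) = card (gset_fixed X H) + card (gset_fixed Y H)"
proof -
  show "finite_action G (gset_sum X Y)"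
    using assms(2,3) monoid.m_closed[OF group.is_monoid[OF assms(1)]]
    by (auto simp: finite_action_def gset_sum_def)
  have "gset_fixed (gset_sum X Y) H = gset_fixed X H <+> gset_fixed Y H"
    by (auto simp: gset_fixed_def gset_sum_def)
  then show "card (gset_fixed (gset_sum X Y) H) = card (gset_fixed X H) + card (gset_fixed Y H)"
    using assms(2,3) by (simp add: card_Plus gset_fixed_def finite_action_def)
qed

lemma gset_prod_finite:
  assumes "group G" "finite_action G X" "finite_action G Y"
  shows "finite_action G (gset_prod X Y)"
    and "card (gset_fixed (gset_prod X Y) H) = card (gset_fixed X H) * card (gset_fixed Y H)"
proof -
  show "finite_action G (gset_prod X Y)"
    using assms(2,3) monoid.m_closed[OF group.is_monoid[OF assms(1)]]
    by (auto simp: finite_action_def gset_prod_def)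
  have "gset_fixed (gset_prod X Y) H = gset_fixed X H \<times> gset_fixed Y H"
    by (auto simp: gset_fixed_def gset_prod_def)
  then show "card (gset_fixed (gset_prod X Y) H) = card (gset_fixed X H) * card (gset_fixed Y H)"
    by (simp add: card_cartesian_product)
qed

lemma trivial_gset_finite:
  assumes "group G" "finite E"
  shows "trivial_gset E \<in> finite_gsets G"
  by (rule finite_action_gsets[OF assms(1)])
    (use assms in \<open>auto simp: finite_action_def trivial_gset_def\<close>)

lemma gset_fixed_trivial [simp]: "gset_fixed (trivial_gset E) H = E"
  by (auto simp: trivial_gset_def gset_fixed_def)

lemma nsum_finite:
  assumes "group G" "X \<in> finite_gsets G" "Y \<in> finite_gsets G"
  shows "nsum X Y \<in> finite_gsets G"
    and "subgroup H G \<Longrightarrow>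
      card (gset_fixed (nsum X Y) H) = card (gset_fixed X H) + card (gset_fixed Y H)"
  using assms finite_gsetsD(1) gset_sum_finite[OF assms(1)]
    gset_image_finite[OF assms(1) _ inj_sum_encode]
  by metis+

lemma nprod_finite:
  assumes "group G" "X \<in> finite_gsets G" "Y \<in> finite_gsets G"
  shows "nprod X Y \<in> finite_gsets G"
    and "subgroup H G \<Longrightarrow>
      card (gset_fixed (nprod X Y) H) = card (gset_fixed X H) * card (gset_fixed Y H)"
  using assms finite_gsetsD(1) gset_prod_finite[OF assms(1)]
    gset_image_finite[OF assms(1) _ inj_prod_encode]
  by metis+

section \<open>Conjugation\<close>

context group
begin

lemma conjugation_closed [simp]:
  "g \<in> carrier G \<Longrightarrow> x \<in> carrier G \<Longrightarrow> conjugation G g x \<in> carrier G"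
  by (simp add: conjugation_def)

lemma conjugation_comp:
  assumes "g \<in> carrier G" "h \<in> carrier G" "x \<in> carrier G"
  shows "conjugation G g (conjugation G h x) = conjugation G (g \<otimes> h) x"
  using assms by (simp add: conjugation_def m_assoc inv_mult_group)

lemma conjugation_inv [simp]:
  assumes "g \<in> carrier G" "x \<in> carrier G"
  shows "conjugation G g (conjugation G (inv g) x) = x"
    "conjugation G (inv g) (conjugation G g x) = x"
  using assms by (simp_all add: conjugation_comp) (simp_all add: conjugation_def)

lemma conjugation_inj_on:
  assumes "g \<in> carrier G" "A \<subseteq> carrier G"
  shows "inj_on (conjugation G g) A"
  by (rule inj_on_inverseI[where g = "conjugation G (inv g)"]) (use assms in auto)

text \<open>The normalizer is defined as the stabilizer of \<open>H\<close> under conjugation of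
  subsets, hence an equality of sets and not an inclusion.\<close>

lemma normalizer_iff:
  assumes "H \<subseteq> carrier G"
  shows "g \<in> normalizer G H \<longleftrightarrow> g \<in> carrier G \<and> conjugation G g ` H = H"
proof -
  have "conjugation G g ` H = g <# H #> inv g"
    by (auto simp: conjugation_def l_coset_def r_coset_def)
  then show ?thesis using assms by (simp add: normalizer_def stabilizer_def)
qed

lemma conjugation_mult:
  assumes "g \<in> carrier G" "x \<in> carrier G" "y \<in> carrier G"
  shows "conjugation G g (x \<otimes> y) = conjugation G g x \<otimes> conjugation G g y"
proof -
  have "inv g \<otimes> (g \<otimes> (y \<otimes> inv g)) = y \<otimes> inv g"
    using assms by (simp flip: m_assoc)
  then show ?thesis using assms by (simp add: conjugation_def m_assoc)
qed

lemma subgroup_conjugation: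
  assumes "subgroup H G" "g \<in> carrier G"
  shows "subgroup (conjugation G g ` H) G"
proof -
  have "conjugation G g ` H = g <# H #> inv g"
    by (auto simp: conjugation_def l_coset_def r_coset_def)
  then show ?thesis using subgroup_conjugation_is_surj2 assms by simp
qed

end

section \<open>Marks and units of the Burnside ring\<close>

text \<open>The value that \<open>mark\<close> picks out of a class, taken at a representative, so
  that it can be used before the relation is known to be an equivalence.\<close>

definition pair_mark :: "'a set \<Rightarrow> 'a virtual_gset \<Rightarrow> int" where
  "pair_mark H v = int (card (gset_fixed (fst v) H)) - int (card (gset_fixed (snd v) H))"

definition pair_mult :: "'a virtual_gset \<Rightarrow> 'a virtual_gset \<Rightarrow> 'a virtual_gset" where
  "pair_mult v w =
     (nsum (nprod (fst v) (fst w)) (nprod (snd v) (snd w)),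
      nsum (nprod (fst v) (snd w)) (nprod (snd v) (fst w)))"

lemma pair_mult_finite:
  assumes "group G" "v \<in> finite_gsets G \<times> finite_gsets G" "w \<in> finite_gsets G \<times> finite_gsets G"
  shows "pair_mult v w \<in> finite_gsets G \<times> finite_gsets G"
    and "subgroup H G \<Longrightarrow> pair_mark H (pair_mult v w) = pair_mark H v * pair_mark H w"
  using assms
  by (auto simp: pair_mult_def pair_mark_def nsum_finite nprod_finite algebra_simps)

lemma mult_burnside_ring:
  "a \<otimes>\<^bsub>burnside_ring G\<^esub> b = (\<Union>v \<in> a. \<Union>w \<in> b. burnside_rel G `` {pair_mult v w})"
  by (simp add: burnside_ring_def pair_mult_def split_def)

locale finite_group = group +
  assumes finite_carrier: "finite (carrier G)"
begin

abbreviation "virtual_gsets \<equiv> finite_gsets G \<times> finite_gsets G"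

text \<open>Counting fixed points turns an isomorphism into an equation of natural numbers, in which
  the summand \<open>Z\<close> cancels. Conversely, equal marks give an isomorphism with the empty
  \<open>Z\<close>, by \<open>gset_iso_of_fixed\<close>. Well-definedness on classes thereby becomes
  a matter of integers.\<close>

lemma burnside_rel_iff:
  "(v, w) \<in> burnside_rel G \<longleftrightarrow> v \<in> virtual_gsets \<and> w \<in> virtual_gsets \<and>
     (\<forall>H. subgroup H G \<longrightarrow> pair_mark H v = pair_mark H w)"
  (is "?L \<longleftrightarrow> ?R")
proof -
  obtain X Y X' Y' where vw: "v = (X, Y)" "w = (X', Y')" by (cases v, cases w) auto
  note fin = nsum_finite[OF is_group]
  show ?thesis
  proof
    assume ?L
    then obtain Z where *: "X \<in> finite_gsets G" "Y \<in> finite_gsets G" "X' \<in> finite_gsets G"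
      "Y' \<in> finite_gsets G" "Z \<in> finite_gsets G"
      and iso: "gset_iso G (nsum (nsum X Y') Z) (nsum (nsum X' Y) Z)"
      by (auto simp: burnside_rel_def vw)
    have "pair_mark H v = pair_mark H w" if "subgroup H G" for H
    proof -
      have "finite_action G (nsum (nsum X Y') Z)"
        using * fin(1) by (intro finite_gsetsD(1)) blast
      then show ?thesis
        using gset_iso_fixed[OF iso subgroup.subset[OF that]] * that
        by (simp add: fin pair_mark_def vw)
    qed
    with * show ?R by (auto simp: vw)
  next
    assume R: ?R
    then have *: "X \<in> finite_gsets G" "Y \<in> finite_gsets G" "X' \<in> finite_gsets G"
      "Y' \<in> finite_gsets G" by (auto simp: vw)
    let ?Z = "trivial_gset {} :: ('a, nat) gset"
    have Z: "?Z \<in> finite_gsets G"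
      by (rule trivial_gset_finite[OF is_group]) simp
    have "card (gset_fixed (nsum (nsum X Y') ?Z) H) = card (gset_fixed (nsum (nsum X' Y) ?Z) H)"
      if "subgroup H G" for H
    proof -
      have "pair_mark H v = pair_mark H w" using R that by blast
      then show ?thesis using that * Z by (simp add: fin pair_mark_def vw)
    qed
    then have "gset_iso G (nsum (nsum X Y') ?Z) (nsum (nsum X' Y) ?Z)"
      by (intro gset_iso_of_fixed finite_carrier finite_gsetsD(1) fin(1) * Z)
    then show ?L using * Z by (auto simp: burnside_rel_def vw)
  qed
qed

lemma equiv_burnside_rel: "equiv virtual_gsets (burnside_rel G)"
  by (rule equivI) (auto simp: refl_on_def sym_def trans_def burnside_rel_iff)

abbreviation burnside_class :: "'a virtual_gset \<Rightarrow> 'a virtual_gset set" where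
  "burnside_class v \<equiv> burnside_rel G `` {v}"

lemma mem_burnside_class:
  assumes "v \<in> virtual_gsets"
  shows "w \<in> burnside_class v \<longleftrightarrow>
    w \<in> virtual_gsets \<and> (\<forall>H. subgroup H G \<longrightarrow> pair_mark H w = pair_mark H v)"
  using assms by (auto simp: burnside_rel_iff)

lemma burnside_class_eqI:
  assumes "v \<in> virtual_gsets" "w \<in> virtual_gsets"
    and "\<And>H. subgroup H G \<Longrightarrow> pair_mark H v = pair_mark H w"
  shows "burnside_class v = burnside_class w"
  by (rule equiv_class_eq[OF equiv_burnside_rel]) (use assms in \<open>simp add: burnside_rel_iff\<close>)

lemma burnside_carrierE:
  assumes "a \<in> carrier (burnside_ring G)"
  obtains v where "v \<in> virtual_gsets" "a = burnside_class v"
  using assms by (auto simp: burnside_ring_def elim!: quotientE)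

lemma burnside_class_carrier:
  "v \<in> virtual_gsets \<Longrightarrow> burnside_class v \<in> carrier (burnside_ring G)"
  by (auto simp: burnside_ring_def intro: quotientI)

lemma mark_burnside_class:
  assumes "v \<in> virtual_gsets" "subgroup H G"
  shows "mark H (burnside_class v) = pair_mark H v"
proof -
  have "(\<lambda>w. pair_mark H w) ` burnside_class v = {pair_mark H v}"
    using assms equiv_class_self[OF equiv_burnside_rel assms(1)]
    by (auto simp: burnside_rel_iff)
  then show ?thesis by (simp add: mark_def pair_mark_def split_def)
qed

theorem mark_inject:
  assumes "a \<in> carrier (burnside_ring G)" "b \<in> carrier (burnside_ring G)"
    and "\<And>H. subgroup H G \<Longrightarrow> mark H a = mark H b"
  shows "a = b"
proof -
  obtain v where v: "v \<in> virtual_gsets" "a = burnside_class v"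
    using burnside_carrierE[OF assms(1)] .
  obtain w where w: "w \<in> virtual_gsets" "b = burnside_class w"
    using burnside_carrierE[OF assms(2)] .
  show ?thesis
    unfolding v(2) w(2)
    by (rule burnside_class_eqI[OF v(1) w(1)])
      (use assms(3) in \<open>simp add: v(2) w(2) mark_burnside_class v(1) w(1)\<close>)
qed

text \<open>Operations on classes are unions over representatives. When the operation depends only
  on marks, all members of the union agree and it collapses.\<close>

lemma Union_burnside_class:
  assumes "v \<in> virtual_gsets"
    and "\<And>w. w \<in> virtual_gsets \<Longrightarrow> (\<And>H. subgroup H G \<Longrightarrow> pair_mark H w = pair_mark H v) \<Longrightarrow> f w = f v"
  shows "(\<Union>w \<in> burnside_class v. f w) = f v"
proof -
  have "v \<in> burnside_class v" by (simp only: mem_burnside_class[OF assms(1)] assms(1) simp_thms)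
  moreover have "f w = f v" if "w \<in> burnside_class v" for w
    using that unfolding mem_burnside_class[OF assms(1)] by (intro assms(2)) simp_all
  ultimately show ?thesis by blast
qed

lemma mult_burnside_class:
  assumes "v \<in> virtual_gsets" "w \<in> virtual_gsets"
  shows "burnside_class v \<otimes>\<^bsub>burnside_ring G\<^esub> burnside_class w = burnside_class (pair_mult v w)"
proof -
  note fin = pair_mult_finite[OF is_group]
  have "(\<Union>w \<in> burnside_class w. burnside_class (pair_mult v w)) = burnside_class (pair_mult v w)"
    if "v \<in> virtual_gsets" for v
    by (rule Union_burnside_class[OF assms(2)], rule burnside_class_eqI)
      (use that assms(2) in \<open>simp_all add: fin\<close>)
  then have "burnside_class v \<otimes>\<^bsub>burnside_ring G\<^esub> burnside_class w =
      (\<Union>v \<in> burnside_class v. burnside_class (pair_mult v w))"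
    using mem_burnside_class[OF assms(1)] by (simp add: mult_burnside_ring)
  also have "\<dots> = burnside_class (pair_mult v w)"
    by (rule Union_burnside_class[OF assms(1)], rule burnside_class_eqI)
      (use assms in \<open>simp_all add: fin\<close>)
  finally show ?thesis .
qed

lemma mark_mult:
  assumes "a \<in> carrier (burnside_ring G)" "b \<in> carrier (burnside_ring G)"
  shows "a \<otimes>\<^bsub>burnside_ring G\<^esub> b \<in> carrier (burnside_ring G)"
    and "subgroup H G \<Longrightarrow> mark H (a \<otimes>\<^bsub>burnside_ring G\<^esub> b) = mark H a * mark H b"
proof -
  obtain v where v: "v \<in> virtual_gsets" "a = burnside_class v"
    using burnside_carrierE[OF assms(1)] .
  obtain w where w: "w \<in> virtual_gsets" "b = burnside_class w"
    using burnside_carrierE[OF assms(2)] .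
  note vw = v w
  note fin = pair_mult_finite[OF is_group v(1) w(1)]
  show "a \<otimes>\<^bsub>burnside_ring G\<^esub> b \<in> carrier (burnside_ring G)"
    using vw fin by (simp add: mult_burnside_class burnside_class_carrier)
  show "mark H (a \<otimes>\<^bsub>burnside_ring G\<^esub> b) = mark H a * mark H b" if "subgroup H G"
    using vw fin that by (simp add: mult_burnside_class mark_burnside_class)
qed

lemma mark_one:
  shows "\<one>\<^bsub>burnside_ring G\<^esub> \<in> carrier (burnside_ring G)"
    and "subgroup H G \<Longrightarrow> mark H \<one>\<^bsub>burnside_ring G\<^esub> = 1"
proof -
  have v: "(trivial_gset {0}, trivial_gset {}) \<in> virtual_gsets"
    by (simp add: trivial_gset_finite[OF is_group])
  have one: "\<one>\<^bsub>burnside_ring G\<^esub> = burnside_class (trivial_gset {0}, trivial_gset {})"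
    by (simp add: burnside_ring_def)
  show "\<one>\<^bsub>burnside_ring G\<^esub> \<in> carrier (burnside_ring G)"
    by (simp only: one burnside_class_carrier[OF v])
  show "mark H \<one>\<^bsub>burnside_ring G\<^esub> = 1" if "subgroup H G"
    by (simp only: one mark_burnside_class[OF v that]) (simp add: pair_mark_def)
qed

text \<open>Signs square to 1, and an element is determined by its marks.\<close>

lemma square_unit:
  assumes "a \<in> carrier (burnside_ring G)" "\<And>H. subgroup H G \<Longrightarrow> mark H a \<in> {1, - 1}"
  shows "a \<otimes>\<^bsub>burnside_ring G\<^esub> a = \<one>\<^bsub>burnside_ring G\<^esub>"
  by (rule mark_inject) (use assms mark_mult mark_one in fastforce)+

text \<open>The marks of a unit divide 1 in the integers, so they are signs; conversely
  \<open>square_unit\<close> exhibits the element as its own inverse.\<close>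

lemma burnside_units:
  "Units (burnside_ring G) =
     {a \<in> carrier (burnside_ring G). \<forall>H. subgroup H G \<longrightarrow> mark H a \<in> {1, - 1}}"
proof (intro equalityI subsetI CollectI conjI allI impI)
  fix a assume "a \<in> Units (burnside_ring G)"
  then obtain b where ab: "a \<in> carrier (burnside_ring G)" "b \<in> carrier (burnside_ring G)"
    "a \<otimes>\<^bsub>burnside_ring G\<^esub> b = \<one>\<^bsub>burnside_ring G\<^esub>" by (auto simp: Units_def)
  then show "a \<in> carrier (burnside_ring G)" by simp
  fix H assume "subgroup H G"
  then have "mark H a * mark H b = 1" using ab mark_mult(2) mark_one(2) by metis
  then show "mark H a \<in> {1, - 1}" using pos_zmult_eq_1_iff_lemma by auto
next
  fix a assume "a \<in> {a \<in> carrier (burnside_ring G). \<forall>H. subgroup H G \<longrightarrow> mark H a \<in> {1, - 1}}"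
  then show "a \<in> Units (burnside_ring G)"
    using square_unit[of a] by (auto simp: Units_def)
qed

text \<open>Associativity and the unit law are read off from marks, where they hold in the integers;
  every element is its own inverse.\<close>

lemma group_burnside_units: "group (units_of (burnside_ring G))"
proof (rule groupI)
  fix x y z assume "x \<in> carrier (units_of (burnside_ring G))"
    "y \<in> carrier (units_of (burnside_ring G))" "z \<in> carrier (units_of (burnside_ring G))"
  then have u: "x \<in> Units (burnside_ring G)" "y \<in> Units (burnside_ring G)"
    "z \<in> Units (burnside_ring G)" by (auto simp: units_of_def)
  have c: "x \<in> carrier (burnside_ring G)" "y \<in> carrier (burnside_ring G)"
    "z \<in> carrier (burnside_ring G)" using u by (auto simp: Units_def)
  show "x \<otimes>\<^bsub>units_of (burnside_ring G)\<^esub> y \<in> carrier (units_of (burnside_ring G))"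
    using u by (fastforce simp: units_of_def burnside_units mark_mult)
  show "x \<otimes>\<^bsub>units_of (burnside_ring G)\<^esub> y \<otimes>\<^bsub>units_of (burnside_ring G)\<^esub> z =
      x \<otimes>\<^bsub>units_of (burnside_ring G)\<^esub> (y \<otimes>\<^bsub>units_of (burnside_ring G)\<^esub> z)"
    unfolding units_of_mult by (rule mark_inject) (use c in \<open>simp_all add: mark_mult\<close>)
next
  show one: "\<one>\<^bsub>units_of (burnside_ring G)\<^esub> \<in> carrier (units_of (burnside_ring G))"
    by (simp add: units_of_def burnside_units mark_one)
  fix x assume "x \<in> carrier (units_of (burnside_ring G))"
  then have u: "x \<in> Units (burnside_ring G)" by (simp add: units_of_def)
  show "\<one>\<^bsub>units_of (burnside_ring G)\<^esub> \<otimes>\<^bsub>units_of (burnside_ring G)\<^esub> x = x"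
    unfolding units_of_mult units_of_one
    by (rule mark_inject) (use u in \<open>simp_all add: mark_mult mark_one burnside_units\<close>)
  show "\<exists>y \<in> carrier (units_of (burnside_ring G)).
      y \<otimes>\<^bsub>units_of (burnside_ring G)\<^esub> x = \<one>\<^bsub>units_of (burnside_ring G)\<^esub>"
    by (rule bexI[of _ x]) (use u square_unit in \<open>auto simp: units_of_def burnside_units\<close>)
qed

text \<open>\<open>x \<mapsto> g x\<close> maps the \<open>H\<close>-fixed points onto those of the conjugate of \<open>H\<close> by \<open>g\<close>.\<close>

lemma fixed_conjugation:
  assumes X: "finite_action G X" and g: "g \<in> carrier G" and H: "subgroup H G"
  shows "card (gset_fixed X (conjugation G g ` H)) = card (gset_fixed X H)"
proof -
  have act: "snd X (g \<otimes> h) z = snd X g (snd X h z)" "snd X \<one> z = z" "snd X g z \<in> fst X"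
    if "g \<in> carrier G" "h \<in> carrier G" "z \<in> fst X" for g h z
    using that X by (auto simp: finite_action_def)
  note Hs = subgroup.mem_carrier[OF H]
  have inv1: "snd X (inv g) (snd X g x) = x" "snd X g (snd X (inv g) x) = x" if "x \<in> fst X" for x
    using that g by (simp_all add: act(2) flip: act(1))
  have conj: "snd X (conjugation G g h) x = snd X g (snd X h (snd X (inv g) x))"
    if "h \<in> H" "x \<in> fst X" for h x
    using that g Hs by (simp add: conjugation_def act)
  have "bij_betw (snd X g) (gset_fixed X H) (gset_fixed X (conjugation G g ` H))"
  proof (rule bij_betw_byWitness[where f' = "snd X (inv g)"])
    show "snd X g ` gset_fixed X H \<subseteq> gset_fixed X (conjugation G g ` H)"
      using g act(3) by (auto simp: gset_fixed_def conj inv1)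
    show "snd X (inv g) ` gset_fixed X (conjugation G g ` H) \<subseteq> gset_fixed X H"
    proof clarify
      fix x assume "x \<in> gset_fixed X (conjugation G g ` H)"
      then have x: "x \<in> fst X" "\<And>h. h \<in> H \<Longrightarrow> snd X (conjugation G g h) x = x"
        by (auto simp: gset_fixed_def)
      have "snd X h (snd X (inv g) x) = snd X (inv g) x" if "h \<in> H" for h
      proof -
        have "snd X g (snd X h (snd X (inv g) x)) = x"
          using x that by (simp add: conj)
        then have "snd X (inv g) (snd X g (snd X h (snd X (inv g) x))) = snd X (inv g) x"
          by simp
        then show ?thesis using x(1) that g Hs act(3) inv1(1) by simp
      qed
      then show "snd X (inv g) x \<in> gset_fixed X H"
        using x(1) g act(3) by (auto simp: gset_fixed_def)
    qed
  qed (auto simp: gset_fixed_def inv1)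
  then show ?thesis using bij_betw_same_card by force
qed

lemma mark_conjugation:
  assumes "a \<in> carrier (burnside_ring G)" "subgroup H G" "g \<in> carrier G"
  shows "mark (conjugation G g ` H) a = mark H a"
proof -
  obtain v where v: "v \<in> virtual_gsets" "a = burnside_class v"
    using burnside_carrierE[OF assms(1)] .
  have "finite_action G (fst v)" "finite_action G (snd v)"
    using v(1) finite_gsetsD(1) by auto
  then have "pair_mark (conjugation G g ` H) v = pair_mark H v"
    by (simp add: pair_mark_def fixed_conjugation assms(2,3))
  then show ?thesis
    by (simp add: v(2) mark_burnside_class[OF v(1)] subgroup_conjugation assms(2,3))
qed

section \<open>Restriction and the action of automorphisms in terms of marks\<close>

lemma finite_group_subgroup:
  assumes "subgroup P G"
  shows "finite_group (G\<lparr>carrier := P\<rparr>)"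
  using subgroup_imp_group[OF assms] subgroup.subset[OF assms] finite_carrier
  by (auto simp: finite_group_def finite_group_axioms_def intro: finite_subset)

text \<open>Every subgroup of \<open>P\<close> is a subgroup of \<open>G\<close>, so representatives
  with equal marks over \<open>G\<close> have equal marks over \<open>P\<close>, and restriction is
  well defined.\<close>

lemma burnside_res_mark:
  assumes "subgroup P G" "a \<in> carrier (burnside_ring G)"
  shows "burnside_res G P a \<in> carrier (burnside_ring (G\<lparr>carrier := P\<rparr>))"
    and "subgroup Q G \<Longrightarrow> Q \<subseteq> P \<Longrightarrow> mark Q (burnside_res G P a) = mark Q a"
proof -
  interpret P: finite_group "G\<lparr>carrier := P\<rparr>" by (rule finite_group_subgroup[OF assms(1)])
  have sub: "finite_gsets G \<subseteq> finite_gsets (G\<lparr>carrier := P\<rparr>)"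
    using group_action.induced_action[OF _ assms(1)] by (auto simp: finite_gsets_def)
  obtain v where v: "v \<in> virtual_gsets" "a = burnside_class v"
    using burnside_carrierE[OF assms(2)] .
  have vP: "v \<in> P.virtual_gsets" using v(1) sub by auto
  have res: "burnside_res G P a = P.burnside_class v"
    unfolding burnside_res_def v(2)
  proof (rule Union_burnside_class[OF v(1)])
    fix w assume w: "w \<in> virtual_gsets" "\<And>H. subgroup H G \<Longrightarrow> pair_mark H w = pair_mark H v"
    then show "P.burnside_class w = P.burnside_class v"
      using sub vP incl_subgroup[OF assms(1)] by (intro P.burnside_class_eqI) auto
  qed
  show "burnside_res G P a \<in> carrier (burnside_ring (G\<lparr>carrier := P\<rparr>))"
    unfolding res by (rule P.burnside_class_carrier[OF vP])
  show "mark Q (burnside_res G P a) = mark Q a" if "subgroup Q G" "Q \<subseteq> P"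
    unfolding res P.mark_burnside_class[OF vP subgroup_incl[OF that(1) assms(1) that(2)]]
    by (simp only: v(2) mark_burnside_class[OF v(1) that(1)])
qed

lemma auto_image_subgroup:
  assumes "\<alpha> \<in> auto G" "subgroup H G"
  shows "subgroup (\<alpha> ` H) G" "subgroup (inv_into (carrier G) \<alpha> ` H) G"
    "\<alpha> ` inv_into (carrier G) \<alpha> ` H = H" "inv_into (carrier G) \<alpha> ` \<alpha> ` H = H"
proof -
  have bij: "bij_betw \<alpha> (carrier G) (carrier G)" and hom: "\<alpha> \<in> hom G G"
    using assms(1) by (auto simp: auto_def Bij_def)
  note H = subgroup.subset[OF assms(2)]
  show "\<alpha> ` inv_into (carrier G) \<alpha> ` H = H" "inv_into (carrier G) \<alpha> ` \<alpha> ` H = H"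
    using bij H by (auto simp: bij_betw_def image_inv_into_cancel inv_into_image_cancel)
  interpret group_hom G G \<alpha> using hom by unfold_locales
  show "subgroup (\<alpha> ` H) G" by (rule subgroup_img_is_subgroup[OF assms(2)])
  \<comment> \<open>\<open>inv_into\<close> need not be extensional, so the library speaks of its
    restriction; membership in \<open>hom\<close> looks only at the carrier.\<close>
  have "inv_into (carrier G) \<alpha> \<in> hom G G"
  proof -
    have "restrict (inv_into (carrier G) \<alpha>) (carrier G) \<in> hom G G"
      using assms(1) by (intro restrict_inv_into_hom) (auto simp: auto_def)
    then show ?thesis by (auto simp: hom_def Pi_iff)
  qed
  then interpret inv: group_hom G G "inv_into (carrier G) \<alpha>" by unfold_locales
  show "subgroup (inv_into (carrier G) \<alpha> ` H) G"
    by (rule inv.subgroup_img_is_subgroup[OF assms(2)])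
qed

lemma gset_twist_finite:
  assumes \<alpha>: "\<alpha> \<in> auto G" and X: "X \<in> finite_gsets G"
  shows "gset_twist G \<alpha> X \<in> finite_gsets G"
    and "gset_fixed (gset_twist G \<alpha> X) H = gset_fixed X (inv_into (carrier G) \<alpha> ` H)"
proof -
  let ?i = "inv_into (carrier G) \<alpha>"
  have "restrict ?i (carrier G) \<in> hom G G"
    using \<alpha> by (intro restrict_inv_into_hom) (auto simp: auto_def)
  then have i: "?i \<in> hom G G" by (auto simp: hom_def Pi_iff)
  then interpret i: group_hom G G ?i by unfold_locales
  show "gset_twist G \<alpha> X \<in> finite_gsets G"
    using finite_gsetsD[OF X]
    by (intro finite_action_gsets is_group) (auto simp: finite_action_def gset_twist_def)
  show "gset_fixed (gset_twist G \<alpha> X) H = gset_fixed X (?i ` H)"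
    by (auto simp: gset_fixed_def gset_twist_def)
qed

text \<open>Marks of a twist are marks at preimages, and preimages of subgroups are subgroups; hence
  twisting respects \<open>burnside_rel\<close>.\<close>

lemma burnside_aut_mark:
  assumes \<alpha>: "\<alpha> \<in> auto G" and a: "a \<in> carrier (burnside_ring G)"
  shows "burnside_aut G \<alpha> a \<in> carrier (burnside_ring G)"
    and "subgroup H G \<Longrightarrow> mark H (burnside_aut G \<alpha> a) = mark (inv_into (carrier G) \<alpha> ` H) a"
proof -
  define t where "t v = (gset_twist G \<alpha> (fst v), gset_twist G \<alpha> (snd v))" for v :: "'a virtual_gset"
  obtain v where v: "v \<in> virtual_gsets" "a = burnside_class v" using burnside_carrierE[OF a] .
  have t: "t w \<in> virtual_gsets" "pair_mark H (t w) = pair_mark (inv_into (carrier G) \<alpha> ` H) w"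
    if "w \<in> virtual_gsets" for w H
    using that by (auto simp: t_def pair_mark_def gset_twist_finite[OF \<alpha>])
  have "burnside_aut G \<alpha> a = (\<Union>w \<in> burnside_class v. burnside_class (t w))"
    by (simp add: burnside_aut_def v(2) t_def split_def)
  also have "\<dots> = burnside_class (t v)"
  proof (rule Union_burnside_class[OF v(1)])
    fix w assume w: "w \<in> virtual_gsets" "\<And>H. subgroup H G \<Longrightarrow> pair_mark H w = pair_mark H v"
    then show "burnside_class (t w) = burnside_class (t v)"
      using v(1) auto_image_subgroup(2)[OF \<alpha>]
      by (intro burnside_class_eqI) (simp_all add: t)
  qed
  finally have eq: "burnside_aut G \<alpha> a = burnside_class (t v)" .
  show "burnside_aut G \<alpha> a \<in> carrier (burnside_ring G)"
    unfolding eq by (rule burnside_class_carrier[OF t(1)[OF v(1)]])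
  show "mark H (burnside_aut G \<alpha> a) = mark (inv_into (carrier G) \<alpha> ` H) a" if "subgroup H G"
    unfolding eq mark_burnside_class[OF t(1)[OF v(1)] that] t(2)[OF v(1)]
    by (simp only: v(2) mark_burnside_class[OF v(1)] auto_image_subgroup(2)[OF \<alpha> that])
qed

lemma conjugation_auto:
  assumes "g \<in> carrier G"
  shows "restrict (conjugation G g) (carrier G) \<in> auto G"
proof -
  have "restrict (conjugation G g) (carrier G) = (\<lambda>h \<in> carrier G. g \<otimes> h \<otimes> inv g)"
    by (rule restrict_ext) (simp add: conjugation_def)
  then have "bij_betw (restrict (conjugation G g) (carrier G)) (carrier G) (carrier G)"
    using conjugation_is_bij[OF assms] by simp
  moreover have "restrict (conjugation G g) (carrier G) \<in> hom G G"
    using assms conjugation_mult by (auto simp: hom_def)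
  ultimately show ?thesis by (auto simp: auto_def Bij_def)
qed

text \<open>Multiplication in \<open>BijGroup\<close> is composition only on bijections; the
  inclusion in \<open>auto G\<close> is what lets the cosets be written with
  \<open>compose\<close>.\<close>

lemma carrier_Out_of:
  assumes "A \<subseteq> auto G"
  shows "carrier (Out_of G A) =
    {{compose (carrier G) \<iota> \<alpha> | \<iota>. \<iota> \<in> Inn G} | \<alpha>. \<alpha> \<in> A}"
proof -
  have Inn: "Inn G \<subseteq> auto G" using conjugation_auto by (auto simp: Inn_def)
  have "Inn G #>\<^bsub>(AutoGroup G)\<lparr>carrier := A\<rparr>\<^esub> \<alpha> = {compose (carrier G) \<iota> \<alpha> | \<iota>. \<iota> \<in> Inn G}"
    if "\<alpha> \<in> A" for \<alpha>
  proof -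
    have "\<iota> \<otimes>\<^bsub>(AutoGroup G)\<lparr>carrier := A\<rparr>\<^esub> \<alpha> = compose (carrier G) \<iota> \<alpha>" if "\<iota> \<in> Inn G" for \<iota>
      using \<open>\<alpha> \<in> A\<close> that assms Inn by (auto simp: AutoGroup_def BijGroup_def auto_def)
    then show ?thesis by (auto simp: r_coset_def)
  qed
  then show ?thesis
    by (auto simp: Out_of_def carrier_FactGroup image_iff)
qed

text \<open>\<open>burnside_out\<close> is a \<open>the_elem\<close> over a coset of
  \<open>Inn G\<close>, so its value is accessible only once all members of the coset are known to
  act alike. After that the outer action is a statement about marks.\<close>

lemma fixed_units_eq:
  assumes A: "A \<subseteq> auto G"
  shows "fixed_units G (carrier (Out_of G A)) =
    {u \<in> Units (burnside_ring G). \<forall>\<alpha> \<in> A. \<forall>H. subgroup H G \<longrightarrow> mark (\<alpha> ` H) u = mark H u}"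
proof -
  have "burnside_out G {compose (carrier G) \<iota> \<alpha> | \<iota>. \<iota> \<in> Inn G} u = u \<longleftrightarrow>
      (\<forall>H. subgroup H G \<longrightarrow> mark (\<alpha> ` H) u = mark H u)"
    if \<alpha>A: "\<alpha> \<in> A" and u: "u \<in> Units (burnside_ring G)" for \<alpha> u
  proof -
    have \<alpha>: "\<alpha> \<in> auto G" using A \<alpha>A by blast
    then have bij: "bij_betw \<alpha> (carrier G) (carrier G)" by (auto simp: auto_def Bij_def)
    have uc: "u \<in> carrier (burnside_ring G)" using u by (simp add: burnside_units)
    have "burnside_aut G (compose (carrier G) \<iota> \<alpha>) u = burnside_aut G \<alpha> u"
      if \<iota>: "\<iota> \<in> Inn G" for \<iota>
    proof (rule mark_inject)
      obtain g where g: "g \<in> carrier G" "\<iota> = restrict (conjugation G g) (carrier G)"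
        using \<iota> by (auto simp: Inn_def)
      let ?c = "compose (carrier G) \<iota> \<alpha>"
      have \<iota>a: "\<iota> \<in> auto G" using g conjugation_auto by simp
      have c: "?c \<in> auto G"
      proof -
        interpret A: group "AutoGroup G" by (rule AutoGroup)
        have "\<iota> \<otimes>\<^bsub>AutoGroup G\<^esub> \<alpha> \<in> carrier (AutoGroup G)"
          using \<iota>a \<alpha> by (intro A.m_closed) (auto simp: AutoGroup_def)
        then show ?thesis using \<iota>a \<alpha> by (simp add: AutoGroup_def BijGroup_def auto_def)
      qed
      show "burnside_aut G ?c u \<in> carrier (burnside_ring G)"
        "burnside_aut G \<alpha> u \<in> carrier (burnside_ring G)"
        by (rule burnside_aut_mark(1)[OF c uc] burnside_aut_mark(1)[OF \<alpha> uc])+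
      fix H assume H: "subgroup H G"
      let ?K = "inv_into (carrier G) ?c ` H"
      have K: "subgroup ?K G" "?c ` ?K = H" by (rule auto_image_subgroup[OF c H])+
      note Ks = subgroup.subset[OF K(1)]
      \<comment> \<open>With \<alpha> h = g, conjugation by \<open>g\<close> after \<alpha> equals
        \<alpha> after conjugation by \<open>h\<close>. The preimages of \<open>H\<close> under the
        two automorphisms are thus conjugate by \<open>h\<close>, which marks do not see.\<close>
      define h where "h = inv_into (carrier G) \<alpha> g"
      have h: "h \<in> carrier G" "\<alpha> h = g"
        using bij_betw_apply[OF bij_betw_inv_into[OF bij] g(1)] bij_betw_inv_into_right[OF bij g(1)]
        by (simp_all add: h_def)
      interpret group_hom G G \<alpha> using \<alpha> by unfold_locales (simp add: auto_def)
      have "(\<lambda>x. \<alpha> (conjugation G h x)) ` ?K = ?c ` ?K"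
      proof (rule image_cong[OF refl])
        fix x assume "x \<in> ?K"
        then have x: "x \<in> carrier G" using Ks by blast
        then show "\<alpha> (conjugation G h x) = ?c x"
          unfolding conjugation_def g(2) using h hom_closed[OF x]
          by (simp add: compose_eq conjugation_def)
      qed
      then have "\<alpha> ` conjugation G h ` ?K = H"
        by (simp only: K(2) image_image[of \<alpha> "conjugation G h" ?K])
      then have "inv_into (carrier G) \<alpha> ` \<alpha> ` conjugation G h ` ?K = inv_into (carrier G) \<alpha> ` H"
        by (simp only:)
      then have "inv_into (carrier G) \<alpha> ` H = conjugation G h ` ?K"
        using auto_image_subgroup(4)[OF \<alpha> subgroup_conjugation[OF K(1) h(1)]] by simp
      then show "mark H (burnside_aut G ?c u) = mark H (burnside_aut G \<alpha> u)"
        using mark_conjugation[OF uc K(1) h(1)]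
        by (simp add: burnside_aut_mark(2)[OF c uc H] burnside_aut_mark(2)[OF \<alpha> uc H])
    qed
    \<comment> \<open>The coset is nonempty, so the image under the action is a singleton and not
      merely contained in one.\<close>
    moreover have "restrict (conjugation G \<one>) (carrier G) \<in> Inn G" by (auto simp: Inn_def)
    ultimately have "(\<lambda>\<beta>. burnside_aut G \<beta> u) ` {compose (carrier G) \<iota> \<alpha> | \<iota>. \<iota> \<in> Inn G}
        = {burnside_aut G \<alpha> u}" by blast
    then have "burnside_out G {compose (carrier G) \<iota> \<alpha> | \<iota>. \<iota> \<in> Inn G} u = burnside_aut G \<alpha> u"
      by (simp add: burnside_out_def)
    also have "burnside_aut G \<alpha> u = u \<longleftrightarrow> (\<forall>H. subgroup H G \<longrightarrow> mark (\<alpha> ` H) u = mark H u)"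
    proof
      assume *: "burnside_aut G \<alpha> u = u"
      show "\<forall>H. subgroup H G \<longrightarrow> mark (\<alpha> ` H) u = mark H u"
      proof (intro allI impI)
        fix H assume H: "subgroup H G"
        have "mark (\<alpha> ` H) (burnside_aut G \<alpha> u) = mark (inv_into (carrier G) \<alpha> ` \<alpha> ` H) u"
          by (rule burnside_aut_mark(2)[OF \<alpha> uc auto_image_subgroup(1)[OF \<alpha> H]])
        then show "mark (\<alpha> ` H) u = mark H u"
          by (simp add: * auto_image_subgroup(4)[OF \<alpha> H])
      qed
    next
      assume *: "\<forall>H. subgroup H G \<longrightarrow> mark (\<alpha> ` H) u = mark H u"
      show "burnside_aut G \<alpha> u = u"
      proof (rule mark_inject[OF burnside_aut_mark(1)[OF \<alpha> uc] uc])
        fix H assume H: "subgroup H G"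
        have "mark (\<alpha> ` inv_into (carrier G) \<alpha> ` H) u = mark (inv_into (carrier G) \<alpha> ` H) u"
          using * auto_image_subgroup(2)[OF \<alpha> H] by blast
        then show "mark H (burnside_aut G \<alpha> u) = mark H u"
          by (simp add: burnside_aut_mark(2)[OF \<alpha> uc H] auto_image_subgroup(3)[OF \<alpha> H])
      qed
    qed
    finally show ?thesis .
  qed
  then show ?thesis unfolding fixed_units_def carrier_Out_of[OF A] by blast
qed

end

section \<open>Sylow subgroups and strong embedding\<close>

text \<open>Orbits of a \<open>p\<close>-group are fixed points or have order divisible by \<open>p\<close>.\<close>

lemma (in group_action) card_fixed_cong:
  assumes p: "prime p" and ord: "order G = p ^ n" and E: "finite E"
  shows "card E mod p = card {x \<in> E. \<forall>g \<in> carrier G. \<phi> g x = x} mod p"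
proof -
  interpret group G using group_hom group_hom.axioms(1) by auto
  let ?F = "{x \<in> E. \<forall>g \<in> carrier G. \<phi> g x = x}"
  have fin: "finite (orbits G E \<phi>)"
    using E by (simp add: orbits_def setcompr_eq_image)
  have "card orb mod p = card (orb \<inter> ?F) mod p" if orb: "orb \<in> orbits G E \<phi>" for orb
  proof -
    obtain x where x: "x \<in> E" "orb = orbit G \<phi> x" using orb by (auto simp: orbits_def)
    have sub: "orb \<subseteq> E" using x element_image by (auto simp: orbit_def)
    have self: "x \<in> orb" using x orbit_refl by simp
    show ?thesis
    proof (cases "orb \<inter> ?F = {}")
      case True
      have "card orb * card (stabilizer G \<phi> x) = p ^ n"
        using orbit_stabilizer_theorem[OF x(1)] x(2) ord by simp
      then have "card orb dvd p ^ n" by (metis dvd_triv_left)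
      then obtain k where k: "card orb = p ^ k" using divides_primepow_nat[OF p] by blast
      have "k \<noteq> 0"
      proof
        assume "k = 0"
        then have "card orb = 1" using k by simp
        then have "orb = {x}" using self by (auto simp: card_1_singleton_iff)
        then have "\<phi> g x = x" if "g \<in> carrier G" for g
          using that x(2) by (auto simp: orbit_def)
        then show False using True self x(1) by auto
      qed
      then show ?thesis using True k by simp
    next
      case False
      then obtain y where y: "y \<in> orb" "y \<in> ?F" by auto
      then have "x \<in> orbit G \<phi> y" using orbit_sym[of x y] x by auto
      then have "y = x" using y(2) by (auto simp: orbit_def)
      then have "orb = {x}" using y x(2) by (auto simp: orbit_def)
      then show ?thesis using y \<open>y = x\<close> by (simp add: Int_absorb2)
    qed
  qed
  then have eq: "(\<Sum>orb \<in> orbits G E \<phi>. card orb) mod p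
      = (\<Sum>orb \<in> orbits G E \<phi>. card (orb \<inter> ?F)) mod p"
    by (subst (1 2) mod_sum_eq[symmetric]) simp
  have finorb: "finite orb" if "orb \<in> orbits G E \<phi>" for orb
    using that orbits_coverture E by (metis Sup_upper finite_subset)
  have "(\<Sum>orb \<in> orbits G E \<phi>. card orb) = card E"
    using disjoint_sum[OF E, of "\<lambda>_. 1::nat"] by simp
  moreover have "(\<Sum>orb \<in> orbits G E \<phi>. card (orb \<inter> ?F)) = card ?F"
  proof -
    have "(\<Sum>orb \<in> orbits G E \<phi>. \<Sum>x \<in> orb. if x \<in> ?F then 1 else 0 :: nat)
        = (\<Sum>x \<in> E. if x \<in> ?F then 1 else 0)"
      by (rule disjoint_sum[OF E])
    moreover have S: "(\<Sum>x \<in> A. if x \<in> ?F then 1 else 0 :: nat) = card (A \<inter> ?F)"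
      if "finite A" for A
      using sum.inter_restrict[OF that, of "\<lambda>_. 1::nat" ?F] by (simp del: mem_Collect_eq)
    moreover have "E \<inter> ?F = ?F" by blast
    ultimately show ?thesis
      unfolding S[OF E] using S[OF finorb] by (simp del: mem_Collect_eq)
  qed
  ultimately show ?thesis using eq by simp
qed

section \<open>Counting fixed cosets: Sylow conjugacy and growth of normalizers\<close>

context finite_group
begin

lemma finite_subgroup: "subgroup H G \<Longrightarrow> finite H"
  using finite_carrier subgroup.subset finite_subset by blast

text \<open>Multiplying by the inverse on the right is a left action of \<open>K\<close> on right
  cosets, to which the orbit congruence applies.\<close>

lemma card_fixed_rcosets:
  assumes p: "prime p" and H: "subgroup H G" and K: "subgroup K G" "card K = p ^ n"
  shows "card (rcosets H) mod p =
    card {C \<in> rcosets H. \<forall>k \<in> K. C #> inv k = C} mod p"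
proof -
  interpret K: finite_group "G\<lparr>carrier := K\<rparr>" by (rule finite_group_subgroup[OF K(1)])
  let ?X = "(rcosets H, \<lambda>k. \<lambda>C \<in> rcosets H. C #> inv k)"
  have sub: "C \<subseteq> carrier G" if "C \<in> rcosets H" for C
    using that subgroup.rcosets_carrier[OF H] is_group by blast
  have cl: "C #> k \<in> rcosets H" if "C \<in> rcosets H" "k \<in> carrier G" for C k
    using that subgroup.subset[OF H] by (auto simp: RCOSETS_def coset_mult_assoc)
  have fin: "finite (rcosets H)"
    using finite_carrier sub by (meson PowI finite_Pow_iff finite_subset subsetI)
  have "finite_action (G\<lparr>carrier := K\<rparr>) ?X"
    using fin cl sub subgroup.mem_carrier[OF K(1)] subgroup.m_closed[OF K(1)]
    by (auto simp: finite_action_def coset_mult_assoc inv_mult_group)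
  then have "?X \<in> finite_gsets (G\<lparr>carrier := K\<rparr>)"
    by (intro finite_action_gsets K.is_group) auto
  then interpret act: group_action "G\<lparr>carrier := K\<rparr>" "rcosets H" "\<lambda>k. \<lambda>C \<in> rcosets H. C #> inv k"
    by (simp add: finite_gsets_def)
  have "card (rcosets H) mod p = card {C \<in> rcosets H. \<forall>g \<in> carrier (G\<lparr>carrier := K\<rparr>).
      (\<lambda>C \<in> rcosets H. C #> inv g) C = C} mod p"
    by (rule act.card_fixed_cong[OF p _ fin]) (simp add: order_def K(2))
  also have "{C \<in> rcosets H. \<forall>g \<in> carrier (G\<lparr>carrier := K\<rparr>). (\<lambda>C \<in> rcosets H. C #> inv g) C = C}
      = {C \<in> rcosets H. \<forall>k \<in> K. C #> inv k = C}"
    by auto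
  finally show ?thesis .
qed

text \<open>A coset of \<open>a\<close> unchanged by \<open>k\<close> puts
  \<open>a \<otimes> k\<close> into \<open>H #> a\<close>; cancelling \<open>a\<close> on the right
  leaves an element of \<open>H\<close>.\<close>

lemma fixed_rcoset_conjugation:
  assumes H: "subgroup H G" and K: "subgroup K G" and a: "a \<in> carrier G"
    and fixed: "\<forall>k \<in> K. H #> a #> inv k = H #> a"
  shows "conjugation G a ` K \<subseteq> H"
proof clarify
  fix k assume k: "k \<in> K"
  then have kG: "k \<in> carrier G" "inv k \<in> K"
    using subgroup.mem_carrier[OF K] subgroup.m_inv_closed[OF K] by auto
  have "H #> a #> inv (inv k) = H #> a" using fixed kG(2) by blast
  then have "H #> (a \<otimes> k) = H #> a"
    using subgroup.subset[OF H] a kG(1) by (simp add: coset_mult_assoc)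
  then have "a \<otimes> k \<in> H #> a" using rcos_self[OF _ H, of "a \<otimes> k"] a kG(1) by simp
  then obtain h where h: "h \<in> H" "a \<otimes> k = h \<otimes> a" by (auto simp: r_coset_def)
  then have "conjugation G a k = h"
    using a kG(1) subgroup.mem_carrier[OF H h(1)] by (simp add: conjugation_def m_assoc)
  then show "conjugation G a k \<in> H" using h(1) by simp
qed

text \<open>The index of a Sylow subgroup is prime to \<open>p\<close>, so the
  \<open>p\<close>-group \<open>K\<close> fixes one of its cosets, and a representative of that
  coset conjugates \<open>K\<close> into \<open>H\<close>.\<close>

theorem sylow_conjugate:
  assumes p: "prime p" and H: "Sylow_subgroup p G H" and K: "subgroup K G" "card K = p ^ n"
  obtains g where "g \<in> carrier G" "conjugation G g ` K \<subseteq> H"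
proof -
  have sH: "subgroup H G" and cH: "card H = p ^ multiplicity p (order G)"
    using H by (auto simp: Sylow_subgroup_def)
  have "order G \<noteq> 0" using finite_carrier one_closed by (auto simp: order_def)
  have "\<not> p dvd card (rcosets H)"
  proof
    assume "p dvd card (rcosets H)"
    then have "p ^ Suc (multiplicity p (order G)) dvd order G"
      using lagrange[OF sH] cH by (metis mult_dvd_mono dvd_refl power_Suc)
    then show False
      using p \<open>order G \<noteq> 0\<close>
        power_dvd_iff_le_multiplicity[of "order G" p "Suc (multiplicity p (order G))"]
      using prime_gt_1_nat[OF p] by (auto simp del: power_Suc)
  qed
  then have "card {C \<in> rcosets H. \<forall>k \<in> K. C #> inv k = C} \<noteq> 0"
    using card_fixed_rcosets[OF p sH K] by (metis dvd_0_right dvd_eq_mod_eq_0)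
  then obtain C where C: "C \<in> rcosets H" "\<forall>k \<in> K. C #> inv k = C"
    by (auto dest!: card_ge_0_finite[OF neq0_conv[THEN iffD1]] simp: card_gt_0_iff)
  then obtain a where "a \<in> carrier G" "C = H #> a" by (auto simp: RCOSETS_def)
  then show ?thesis using that fixed_rcoset_conjugation[OF sH K(1)] C(2) by blast
qed

text \<open>Let \<open>H\<close> act on its own cosets. Their number is a nontrivial power of
  \<open>p\<close>, so \<open>p\<close> divides the number of fixed cosets. As \<open>H\<close> is
  one of them, there is another, and its representative normalizes \<open>H\<close> without lying in
  it.\<close>

theorem normalizer_grows:
  assumes p: "prime p" and ord: "order G = p ^ n" and H: "subgroup H G" "H \<noteq> carrier G"
  shows "H \<subset> normalizer G H"
proof -
  note sub = subgroup.subset[OF H(1)]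
  have "card H dvd p ^ n" using lagrange[OF H(1)] ord by (metis dvd_triv_right)
  then obtain m where m: "card H = p ^ m" using divides_primepow_nat[OF p] by blast
  have "card (rcosets H) dvd p ^ n" using lagrange[OF H(1)] ord by (metis dvd_triv_left)
  then obtain k where k: "card (rcosets H) = p ^ k" using divides_primepow_nat[OF p] by blast
  have "card H \<noteq> card (carrier G)"
    using card_subset_eq[OF finite_carrier sub] H(2) by blast
  then have "k \<noteq> 0" using lagrange[OF H(1)] k by (metis mult_1 order_def power_0)
  let ?F = "{C \<in> rcosets H. \<forall>k \<in> H. C #> inv k = C}"
  have dvd: "p dvd card ?F"
    using card_fixed_rcosets[OF p H(1) H(1) m] k dvd_power[of k p] \<open>k \<noteq> 0\<close>
    by (simp add: dvd_eq_mod_eq_0)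
  have HF: "H \<in> ?F"
    using subgroup.subgroup_in_rcosets[OF H(1) is_group] H(1) coset_join2[OF _ H(1)]
      subgroup.m_inv_closed[OF H(1)] subgroup.mem_carrier[OF H(1)] by auto
  have "?F \<noteq> {H}"
    using dvd prime_gt_1_nat[OF p] by (metis card_1_singleton_iff nat_dvd_1_iff_1 less_irrefl One_nat_def)
  then obtain C where C: "C \<in> rcosets H" "C \<noteq> H" "\<forall>k \<in> H. C #> inv k = C" using HF by auto
  then obtain a where a: "a \<in> carrier G" "C = H #> a" by (auto simp: RCOSETS_def)
  have "a \<notin> H" using C(2) a coset_join2[OF a(1) H(1)] by auto
  have "conjugation G a ` H \<subseteq> H"
    using fixed_rcoset_conjugation[OF H(1) H(1) a(1)] C(3) a(2) by blast
  moreover have "card (conjugation G a ` H) = card H"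
    by (rule card_image[OF conjugation_inj_on[OF a(1) sub]])
  ultimately have "conjugation G a ` H = H"
    using card_subset_eq[OF finite_subgroup[OF H(1)]] by blast
  then have "a \<in> normalizer G H" using a(1) normalizer_iff[OF sub] by blast
  moreover have "H \<subseteq> normalizer G H"
  proof
    fix h assume h: "h \<in> H"
    then have hG: "h \<in> carrier G" using sub by blast
    have sub': "conjugation G h ` H \<subseteq> H"
      using h H(1) by (auto simp: conjugation_def subgroup.m_closed subgroup.m_inv_closed)
    have "card (conjugation G h ` H) = card H"
      by (rule card_image[OF conjugation_inj_on[OF hG sub]])
    then have "conjugation G h ` H = H"
      by (rule card_subset_eq[OF finite_subgroup[OF H(1)] sub'])
    then show "h \<in> normalizer G H"
      unfolding normalizer_iff[OF sub] using hG by simp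
  qed
  ultimately show ?thesis using \<open>a \<notin> H\<close> by blast
qed

text \<open>
  A subgroup \<open>L\<close> of \<open>G/N\<close> of order divisible by \<open>p\<close> has a preimage with a \<open>p\<close>-subgroup
  of order \<open>p |N|\<close>.
\<close>

lemma strongly_embedded_Mod:
  assumes p: "prime p" and N: "N \<lhd> G" "card N = p ^ n"
    and H: "subgroup H G" "N \<subseteq> H" "H \<noteq> carrier G"
    and T: "subgroup T G" "T \<subseteq> H" "N \<subset> T" "card T = p ^ t"
    and step: "\<And>x K k. \<lbrakk>x \<in> carrier G - H; subgroup K G; card K = p ^ k; \<not> K \<subseteq> N;
      K \<subseteq> H; conjugation G (inv x) ` K \<subseteq> H\<rbrakk> \<Longrightarrow> False"
  shows "strongly_embedded p (G Mod N) ((\<lambda>h. N #> h) ` H)"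
proof -
  interpret N: normal N G by (rule N(1))
  let ?Q = "G Mod N" and ?\<pi> = "\<lambda>h. N #> h"
  interpret Q: group ?Q by (rule N.factorgroup_is_group)
  have \<pi>: "?\<pi> \<in> hom G ?Q" by (rule N.r_coset_hom_Mod)
  interpret \<pi>: group_hom G ?Q ?\<pi> by unfold_locales (rule \<pi>)
  have invQ: "inv\<^bsub>?Q\<^esub> (?\<pi> x) = ?\<pi> (inv x)" if "x \<in> carrier G" for x
    using that by simp
  have NsG: "subgroup N G" by (rule normal_imp_subgroup[OF N(1)])
  have mem: "y \<in> ?\<pi> x \<longleftrightarrow> ?\<pi> y = ?\<pi> x" if "x \<in> carrier G" "y \<in> carrier G" for x y
    using that repr_independence[OF _ that(1) NsG] rcos_self[OF that(2) NsG] by auto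
  \<comment> \<open>The union of a set of cosets is its full preimage, so subgroups of the quotient
    can be counted upstairs as partitions into cosets.\<close>
  have preimage: "\<Union> L = {y \<in> carrier G. ?\<pi> y \<in> L}" if "L \<subseteq> carrier ?Q" for L
  proof -
    have "y \<in> carrier G \<and> ?\<pi> y \<in> L" if "C \<in> L" "y \<in> C" for C y
    proof -
      obtain x where x: "x \<in> carrier G" "C = ?\<pi> x"
        using \<open>C \<in> L\<close> \<open>L \<subseteq> carrier ?Q\<close> by (auto simp: carrier_FactGroup)
      then have "y \<in> carrier G"
        using \<open>y \<in> C\<close> r_coset_subset_G[OF subgroup.subset[OF NsG] x(1)] by blast
      then show ?thesis using x \<open>y \<in> C\<close> \<open>C \<in> L\<close> mem by auto
    qed
    then show ?thesis using rcos_self[OF _ NsG] by blast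
  qed
  have card_preimage: "card N * card L = card (\<Union> L)" if "L \<subseteq> carrier ?Q" for L
  proof (rule card_partition)
    have fin: "finite (carrier G)" by (rule finite_carrier)
    show "finite (\<Union> L)" using preimage[OF that] fin by simp
    show "finite L" using that fin by (auto simp: carrier_FactGroup intro: finite_subset)
    fix c assume "c \<in> L"
    then show "card c = card N"
      using that card_rcosets_equal[OF _ subgroup.subset[OF NsG]] by (auto simp: FactGroup_def)
  next
    fix c d assume "c \<in> L" "d \<in> L" "c \<noteq> d"
    then show "c \<inter> d = {}"
      using that rcos_disjoint[OF NsG] by (auto simp: FactGroup_def pairwise_def disjnt_def)
  qed
  have subgroup_preimage: "subgroup {y \<in> carrier G. ?\<pi> y \<in> L} G" if L: "subgroup L ?Q" for L
  proof (rule subgroupI)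
    have "?\<pi> \<one> \<in> L" using subgroup.one_closed[OF L] \<pi>.hom_one by metis
    then show "{y \<in> carrier G. ?\<pi> y \<in> L} \<noteq> {}" by blast
  next
    fix y assume y: "y \<in> {y \<in> carrier G. ?\<pi> y \<in> L}"
    then have "y \<in> carrier G" "?\<pi> y \<in> L" by blast+
    then have "?\<pi> (inv y) \<in> L"
      using subgroup.m_inv_closed[OF L, of "?\<pi> y"] by (simp only: invQ)
    then show "inv y \<in> {y \<in> carrier G. ?\<pi> y \<in> L}" using y by simp
  next
    fix y z assume yz: "y \<in> {y \<in> carrier G. ?\<pi> y \<in> L}" "z \<in> {y \<in> carrier G. ?\<pi> y \<in> L}"
    then have "y \<in> carrier G" "?\<pi> y \<in> L" "z \<in> carrier G" "?\<pi> z \<in> L" by blast+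
    then have "?\<pi> (y \<otimes> z) \<in> L"
      using subgroup.m_closed[OF L, of "?\<pi> y" "?\<pi> z"] by (simp only: \<pi>.hom_mult)
    then show "y \<otimes> z \<in> {y \<in> carrier G. ?\<pi> y \<in> L}" using yz by simp
  qed auto
  let ?H = "?\<pi> ` H"
  have HQ: "subgroup ?H ?Q" by (rule \<pi>.subgroup_img_is_subgroup[OF H(1)])
  have inH: "y \<in> H" if "?\<pi> y \<in> ?H" "y \<in> carrier G" for y
  proof -
    obtain h where h: "h \<in> H" "?\<pi> y = ?\<pi> h" using \<open>?\<pi> y \<in> ?H\<close> by auto
    then have "y \<in> ?\<pi> h" using mem that(2) subgroup.mem_carrier[OF H(1)] by blast
    then show ?thesis using h(1) H(2) subgroup.m_closed[OF H(1)] by (auto simp: r_coset_def)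
  qed
  have UH: "\<Union> ?H = H"
    unfolding preimage[OF subgroup.subset[OF HQ]]
    using inH subgroup.mem_carrier[OF H(1)] by blast
  show ?thesis
    unfolding strongly_embedded_def
  proof (intro conjI ballI)
    show "subgroup ?H ?Q" by (rule HQ)
    show "?H \<noteq> carrier ?Q"
    proof
      assume "?H = carrier ?Q"
      then have "carrier G \<subseteq> H" using inH \<pi>.hom_closed by (metis subsetI)
      then show False using H(3) subgroup.subset[OF H(1)] by blast
    qed
    \<comment> \<open>The image of \<open>T\<close> has order a power of \<open>p\<close>, since its
      cosets partition \<open>T\<close>, and it is nontrivial because \<open>T\<close> exceeds
      \<open>N\<close>.\<close>
    show "p dvd card ?H"
    proof -
      let ?T = "?\<pi> ` T"
      have TQ: "subgroup ?T ?Q" by (rule \<pi>.subgroup_img_is_subgroup[OF T(1)])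
      have "card ?T \<noteq> 1"
      proof
        assume "card ?T = 1"
        then obtain C where C: "?T = {C}" by (rule card_1_singletonE)
        have "T \<subseteq> N"
        proof
          fix t assume t: "t \<in> T"
          then have "?\<pi> t \<in> {C}" "?\<pi> \<one> \<in> {C}"
            unfolding C[symmetric] using subgroup.one_closed[OF T(1)] by (blast intro: imageI)+
          then have "?\<pi> t = ?\<pi> \<one>" by (metis singletonD)
          then show "t \<in> N"
            using rcos_self[OF subgroup.mem_carrier[OF T(1) t] NsG] subgroup.subset[OF NsG] by simp
        qed
        then show False using T(3) by blast
      qed
      moreover have "card ?T dvd p ^ t"
      proof -
        have UT: "\<Union> ?T = T"
        proof -
          have "y \<in> T" if "y \<in> ?\<pi> t" "t \<in> T" for y t
            using that T(3) subgroup.m_closed[OF T(1)] by (auto simp: r_coset_def)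
          then show ?thesis using rcos_self[OF _ NsG] subgroup.mem_carrier[OF T(1)] by blast
        qed
        then show ?thesis
          using card_preimage[OF subgroup.subset[OF TQ]] T(4) by (metis dvd_triv_right)
      qed
      ultimately have "p dvd card ?T"
        using divides_primepow_nat[OF p] by (metis dvd_power power_0 gr0I)
      moreover have "card ?T dvd card ?H"
      proof -
        interpret HQ: group "?Q\<lparr>carrier := ?H\<rparr>" by (rule Q.subgroup_imp_group[OF HQ])
        have "subgroup ?T (?Q\<lparr>carrier := ?H\<rparr>)" using T(2) by (intro Q.subgroup_incl TQ HQ) blast
        then obtain c where "c * card ?T = card ?H"
          using HQ.lagrange by (auto simp: order_def)
        then show ?thesis by (metis dvd_triv_right)
      qed
      ultimately show ?thesis by (rule dvd_trans)
    qed
  next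
    fix X assume X: "X \<in> carrier ?Q - ?H"
    then obtain x where x: "x \<in> carrier G" "X = ?\<pi> x" by (auto simp: carrier_FactGroup)
    then have "x \<notin> H" using X by blast
    let ?L = "?H \<inter> conjugation ?Q X ` ?H"
    show "\<not> p dvd card ?L"
    proof
      assume dvd: "p dvd card ?L"
      have XQ: "X \<in> carrier ?Q" using X by blast
      have conjH: "conjugation ?Q X ` ?H = X <#\<^bsub>?Q\<^esub> ?H #>\<^bsub>?Q\<^esub> inv\<^bsub>?Q\<^esub> X"
        by (auto simp: conjugation_def l_coset_def r_coset_def)
      have L: "subgroup ?L ?Q"
        unfolding conjH using Q.subgroup_conjugation_is_surj2[OF XQ HQ]
        by (rule Q.subgroups_Inter_pair[OF HQ])
      note LQ = subgroup.subset[OF L]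
      let ?P = "\<Union> ?L"
      have Peq: "?P = {y \<in> carrier G. ?\<pi> y \<in> ?L}" by (rule preimage[OF LQ])
      have P: "subgroup ?P G"
        unfolding Peq by (rule subgroup_preimage[OF L])
      have "card N * card ?L = card ?P" by (rule card_preimage[OF LQ])
      then have "p ^ Suc n dvd card ?P" using N(2) dvd by (metis mult_dvd_mono dvd_refl power_Suc2)
      then obtain m where m: "card ?P = p ^ Suc n * m" by blast
      interpret P: finite_group "G\<lparr>carrier := ?P\<rparr>" by (rule finite_group_subgroup[OF P])
      \<comment> \<open>One factor \<open>p\<close> more than in \<open>card N\<close> is enough to
        keep \<open>K\<close> from lying in \<open>N\<close>.\<close>
      obtain K where K: "subgroup K (G\<lparr>carrier := ?P\<rparr>)" "card K = p ^ Suc n"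
        using sylow_thm[OF p P.is_group, of "Suc n" m] m P.finite_carrier by (auto simp: order_def)
      have KG: "subgroup K G" by (rule incl_subgroup[OF P K(1)])
      have KP: "K \<subseteq> ?P" using subgroup.subset[OF K(1)] by simp
      have "\<not> K \<subseteq> N"
      proof
        assume "K \<subseteq> N"
        then have "card K \<le> card N" by (rule card_mono[OF finite_subgroup[OF NsG]])
        then show False using K(2) N(2) prime_gt_1_nat[OF p] by simp
      qed
      moreover have "K \<subseteq> H" using KP UH by auto
      \<comment> \<open>As \<open>H\<close> contains \<open>N\<close>, membership in
        \<open>H\<close> can be tested modulo \<open>N\<close>, where the elements of
        \<open>K\<close> lie in the conjugate of \<open>?H\<close> by \<open>X\<close>.\<close>
      moreover have "conjugation G (inv x) ` K \<subseteq> H"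
      proof clarify
        fix y assume "y \<in> K"
        then have y: "y \<in> carrier G" "?\<pi> y \<in> conjugation ?Q X ` ?H" using KP Peq by auto
        then obtain h where h: "h \<in> H" "?\<pi> y = conjugation ?Q X (?\<pi> h)" by blast
        have hG: "h \<in> carrier G" using h(1) subgroup.mem_carrier[OF H(1)] by blast
        have "conjugation ?Q X (?\<pi> h) = ?\<pi> (conjugation G x h)"
          using x hG by (simp add: conjugation_def del: mult_FactGroup)
        then have "?\<pi> (conjugation G (inv x) y) = ?\<pi> (conjugation G (inv x) (conjugation G x h))"
          using h(2) x(1) y(1) hG by (simp add: conjugation_def[of G "inv x"] del: mult_FactGroup)
        then have "?\<pi> (conjugation G (inv x) y) = ?\<pi> h" using x(1) hG by simp
        then have "?\<pi> (conjugation G (inv x) y) \<in> ?H" using h(1) by (metis imageI)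
        then show "conjugation G (inv x) y \<in> H"
          by (rule inH) (simp add: x(1) y(1))
      qed
      ultimately show False using step[OF _ KG K(2)] x(1) \<open>x \<notin> H\<close> by blast
    qed
  qed
qed

end

text \<open>Corestricted to its image the map is onto, so the isomorphism theorem turns the order of
  the image into the index of the kernel.\<close>

lemma (in group_hom) card_image_dvd:
  assumes "finite (carrier G)"
  shows "card (h ` carrier G) dvd order G"
proof -
  let ?I = "H\<lparr>carrier := h ` carrier G\<rparr>"
  have sub: "subgroup (h ` carrier G) H" by (rule img_is_subgroup)
  interpret I: group ?I by (rule H.subgroup_imp_group[OF sub])
  interpret hI: group_hom G ?I h
    by unfold_locales (auto simp: hom_def)
  have "(\<lambda>X. the_elem (h ` X)) \<in> iso (G Mod kernel G ?I h) ?I"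
    by (rule hI.FactGroup_iso_set) simp
  then have "card (carrier (G Mod kernel G ?I h)) = card (h ` carrier G)"
    using bij_betw_same_card by (auto simp: iso_def)
  then have "card (rcosets\<^bsub>G\<^esub> (kernel G ?I h)) = card (h ` carrier G)"
    by (simp add: FactGroup_def)
  then show ?thesis using G.lagrange[OF hI.subgroup_kernel] by (metis dvd_triv_left)
qed

text \<open>\<open>card T\<close> divides \<open>card H\<close>, which divides
  \<open>order G\<close>, so the last two have the same \<open>p\<close>-part.\<close>

lemma (in finite_group) Sylow_subgroup_mono:
  assumes p: "prime p" and T: "Sylow_subgroup p G T" and H: "subgroup H G" "T \<subseteq> H"
  shows "Sylow_subgroup p (G\<lparr>carrier := H\<rparr>) T"
proof -
  have sT: "subgroup T G" and cT: "card T = p ^ multiplicity p (order G)"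
    using T by (auto simp: Sylow_subgroup_def)
  interpret H: group "G\<lparr>carrier := H\<rparr>" by (rule subgroup_imp_group[OF H(1)])
  have sTH: "subgroup T (G\<lparr>carrier := H\<rparr>)" by (rule subgroup_incl[OF sT H])
  obtain c where "c * card T = card H" using H.lagrange[OF sTH] by (auto simp: order_def)
  then have 1: "card T dvd card H" by (metis dvd_triv_right)
  have 2: "card H dvd order G" using lagrange[OF H(1)] by (metis dvd_triv_right)
  have nz: "order G \<noteq> 0" using finite_carrier one_closed by (auto simp: order_def)
  then have nzH: "card H \<noteq> 0" using 2 by auto
  have pu: "\<not> is_unit p" using prime_gt_1_nat[OF p] by auto
  have "multiplicity p (card H) \<le> multiplicity p (order G)"
    by (rule dvd_imp_multiplicity_le[OF 2 nz])
  moreover have "multiplicity p (order G) \<le> multiplicity p (card H)"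
    using 1 cT nzH pu power_dvd_iff_le_multiplicity by metis
  ultimately show ?thesis using sTH cT by (simp add: Sylow_subgroup_def order_def)
qed

section \<open>Fusion systems\<close>

sublocale fusion_system \<subseteq> finite_group S
  by unfold_locales (rule finite_S)

context fusion_system
begin

lemma F_funcset: "\<lbrakk>subgroup P S; subgroup Q S; f \<in> F P Q; x \<in> P\<rbrakk> \<Longrightarrow> f x \<in> Q"
  using F_sub[of P Q f] by (auto simp: hom_def)

lemma F_mult:
  "\<lbrakk>subgroup P S; subgroup Q S; f \<in> F P Q; x \<in> P; y \<in> P\<rbrakk> \<Longrightarrow> f (x \<otimes> y) = f x \<otimes> f y"
  using F_sub[of P Q f] by (auto simp: hom_def)

lemma F_group_hom:
  assumes "subgroup P S" "subgroup Q S" "f \<in> F P Q"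
  shows "group_hom (S\<lparr>carrier := P\<rparr>) S f"
proof -
  interpret P: group "S\<lparr>carrier := P\<rparr>" by (rule subgroup_imp_group[OF assms(1)])
  show ?thesis
    using F_funcset[OF assms] F_mult[OF assms] subgroup.mem_carrier[OF assms(2)]
    by unfold_locales (auto simp: hom_def)
qed

lemma F_image_subgroup:
  assumes "subgroup P S" "subgroup Q S" "f \<in> F P Q" "subgroup A S" "A \<subseteq> P"
  shows "subgroup (f ` A) S"
proof -
  have "subgroup A (S\<lparr>carrier := P\<rparr>)" by (rule subgroup_incl[OF assms(4,1,5)])
  then show ?thesis by (rule group_hom.subgroup_img_is_subgroup[OF F_group_hom[OF assms(1-3)]])
qed

lemma F_inv:
  assumes "subgroup P S" "subgroup Q S" "f \<in> F P Q" "x \<in> P"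
  shows "f (inv x) = inv (f x)"
  using group_hom.hom_inv[OF F_group_hom[OF assms(1-3)], of x] assms(4)
    m_inv_consistent[OF assms(1,4)] by simp

lemma F_conjugation:
  assumes P: "subgroup P S" and Q: "subgroup Q S" and f: "f \<in> F P Q" and g: "g \<in> P" and x: "x \<in> P"
  shows "f (conjugation S g x) = conjugation S (f g) (f x)"
  using g x F_mult[OF P Q f] F_inv[OF P Q f] subgroup.m_closed[OF P] subgroup.m_inv_closed[OF P]
  by (simp add: conjugation_def)

lemma F_incl:
  assumes "subgroup A S" "subgroup P S" "A \<subseteq> P"
  shows "(\<lambda>x \<in> A. x) \<in> F A P"
proof -
  have "conjugation S \<one> x = x" if "x \<in> A" for x
    using that subgroup.mem_carrier[OF assms(1)] by (simp add: conjugation_def)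
  then have "(\<lambda>x \<in> A. x) = restrict (conjugation S \<one>) A" "conjugation S \<one> ` A \<subseteq> P"
    using assms(3) by (auto cong: restrict_cong)
  then have "(\<lambda>x \<in> A. x) \<in> Hom_conj S A P" by (auto simp: Hom_conj_def)
  then show ?thesis using F_conj[OF assms(1,2)] by blast
qed

lemma F_restrict:
  assumes "subgroup P S" "subgroup Q S" "f \<in> F P Q" "subgroup A S" "A \<subseteq> P"
  shows "restrict f A \<in> F A Q"
proof -
  have "compose A f (\<lambda>x \<in> A. x) \<in> F A Q"
    by (rule F_comp[OF assms(4,1,2) F_incl[OF assms(4,1,5)] assms(3)])
  moreover have "compose A f (\<lambda>x \<in> A. x) = restrict f A"
    by (auto simp: compose_def restrict_def)
  ultimately show ?thesis by simp
qed

lemma Iso_F: "f \<in> Iso_fus F P Q \<Longrightarrow> f \<in> F P Q"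
  by (simp add: Iso_fus_def)

lemma Iso_inverse:
  assumes P: "subgroup P S" and Q: "subgroup Q S" and f: "f \<in> Iso_fus F P Q"
  obtains h where "h \<in> Iso_fus F Q P" "\<And>x. x \<in> P \<Longrightarrow> h (f x) = x" "\<And>y. y \<in> Q \<Longrightarrow> f (h y) = y"
proof -
  obtain h where h: "h \<in> F Q P" "compose P h f = (\<lambda>x \<in> P. x)" "compose Q f h = (\<lambda>y \<in> Q. y)"
    using f by (auto simp: Iso_fus_def)
  have "h \<in> Iso_fus F Q P" using h f by (auto simp: Iso_fus_def)
  moreover have "h (f x) = x" if "x \<in> P" for x using fun_cong[OF h(2), of x] that by (simp add: compose_eq)
  moreover have "f (h y) = y" if "y \<in> Q" for y using fun_cong[OF h(3), of y] that by (simp add: compose_eq)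
  ultimately show ?thesis by (rule that)
qed

lemma Iso_image:
  assumes P: "subgroup P S" and Q: "subgroup Q S" and f: "f \<in> Iso_fus F P Q"
  shows "f ` P = Q"
proof -
  obtain h where h: "h \<in> Iso_fus F Q P" "\<And>y. y \<in> Q \<Longrightarrow> f (h y) = y"
    using Iso_inverse[OF assms] by metis
  show ?thesis
  proof (intro equalityI subsetI)
    fix y assume "y \<in> Q"
    then show "y \<in> f ` P" using h(2) F_funcset[OF Q P Iso_F[OF h(1)]] by (metis imageI)
  qed (use F_funcset[OF P Q Iso_F[OF f]] in auto)
qed

text \<open>The inclusion in \<open>F_factor\<close> changes no values and both maps are extensional
  on \<open>P\<close>. So the isomorphism there is \<open>f\<close> itself, and its target must be
  the image.\<close>

lemma F_onto_image:
  assumes P: "subgroup P S" and Q: "subgroup Q S" and f: "f \<in> F P Q"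
  shows "f \<in> Iso_fus F P (f ` P)" "subgroup (f ` P) S"
proof -
  obtain R h where R: "subgroup R S" "R \<subseteq> Q" and h: "h \<in> Iso_fus F P R"
    and eq: "f = compose P (\<lambda>x \<in> R. x) h"
    using F_factor[OF assms] by blast
  have hP: "h ` P = R" by (rule Iso_image[OF P R(1) h])
  have "f = h"
    by (rule extensionalityI[of _ P])
      (use F_sub[OF P Q f] F_sub[OF P R(1) Iso_F[OF h]] hP in \<open>auto simp: eq compose_eq\<close>)
  then show "f \<in> Iso_fus F P (f ` P)" "subgroup (f ` P) S" using h hP R(1) by simp_all
qed

text \<open>An injective map of a finite set into itself is onto.\<close>

lemma F_self_iso:
  assumes P: "subgroup P S" and f: "f \<in> F P P"
  shows "f \<in> Iso_fus F P P"
proof -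
  have "f ` P \<subseteq> P" using F_funcset[OF P P f] by blast
  moreover have "card (f ` P) = card P" using F_sub[OF P P f] card_image by blast
  ultimately have "f ` P = P" using card_subset_eq[OF finite_subgroup[OF P]] by blast
  then show ?thesis using F_onto_image(1)[OF P P f] by simp
qed

lemma Iso_compose:
  assumes P: "subgroup P S" and Q: "subgroup Q S" and R: "subgroup R S"
    and f: "f \<in> Iso_fus F P Q" and g: "g \<in> Iso_fus F Q R"
  shows "compose P g f \<in> Iso_fus F P R"
proof -
  have gf: "compose P g f \<in> F P R" by (rule F_comp[OF P Q R Iso_F[OF f] Iso_F[OF g]])
  have "compose P g f ` P = g ` f ` P" by (auto simp: compose_def image_iff)
  then have "compose P g f ` P = R" using Iso_image[OF P Q f] Iso_image[OF Q R g] by simp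
  then show ?thesis using F_onto_image(1)[OF P R gf] by simp
qed

lemma fus_conj_sym:
  assumes "subgroup P S" "subgroup Q S" "fus_conj F P Q"
  shows "fus_conj F Q P"
proof -
  obtain f where f: "f \<in> Iso_fus F P Q" using assms(3) by (auto simp: fus_conj_def)
  obtain h where "h \<in> Iso_fus F Q P" using Iso_inverse[OF assms(1,2) f] .
  then show ?thesis by (auto simp: fus_conj_def)
qed

lemma fus_conj_card:
  assumes "subgroup P S" "subgroup Q S" "fus_conj F P Q"
  shows "card P = card Q"
proof -
  obtain f where f: "f \<in> Iso_fus F P Q" using assms(3) by (auto simp: fus_conj_def)
  have "inj_on f P" using F_sub[OF assms(1,2) Iso_F[OF f]] by blast
  then show ?thesis using Iso_image[OF assms(1,2) f] card_image by metis
qed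

section \<open>Automorphism groups in a fusion system\<close>

lemma F_auto:
  assumes P: "subgroup P S"
  shows "F P P \<subseteq> auto (S\<lparr>carrier := P\<rparr>)"
  using F_sub[OF P P] Iso_image[OF P P F_self_iso[OF P]]
  by (auto simp: auto_def Bij_def bij_betw_def)

lemma Aut_fus_simps:
  assumes P: "subgroup P S"
  shows "carrier (Aut_fus S F P) = F P P"
    and "\<one>\<^bsub>Aut_fus S F P\<^esub> = (\<lambda>x \<in> P. x)"
    and "\<alpha> \<in> F P P \<Longrightarrow> \<beta> \<in> F P P \<Longrightarrow> \<alpha> \<otimes>\<^bsub>Aut_fus S F P\<^esub> \<beta> = compose P \<alpha> \<beta>"
  using F_auto[OF P] by (auto simp: Aut_fus_def AutoGroup_def BijGroup_def auto_def)

lemma Aut_fus_finite_group: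
  assumes P: "subgroup P S"
  shows "finite_group (Aut_fus S F P)"
proof -
  note simps = Aut_fus_simps[OF P]
  have "group (Aut_fus S F P)"
  proof (rule groupI)
    fix x y assume "x \<in> carrier (Aut_fus S F P)" "y \<in> carrier (Aut_fus S F P)"
    then show "x \<otimes>\<^bsub>Aut_fus S F P\<^esub> y \<in> carrier (Aut_fus S F P)"
      using F_comp[OF P P P] by (simp add: simps)
  next
    show "\<one>\<^bsub>Aut_fus S F P\<^esub> \<in> carrier (Aut_fus S F P)"
      using F_id[OF P] by (simp add: simps)
  next
    fix x y z assume xyz: "x \<in> carrier (Aut_fus S F P)" "y \<in> carrier (Aut_fus S F P)"
      "z \<in> carrier (Aut_fus S F P)"
    then have "z \<in> P \<rightarrow> P" using F_funcset[OF P P] by (auto simp: simps)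
    then have "compose P x (compose P y z) = compose P (compose P x y) z"
      using compose_assoc by metis
    then show "x \<otimes>\<^bsub>Aut_fus S F P\<^esub> y \<otimes>\<^bsub>Aut_fus S F P\<^esub> z
        = x \<otimes>\<^bsub>Aut_fus S F P\<^esub> (y \<otimes>\<^bsub>Aut_fus S F P\<^esub> z)"
      using xyz F_comp[OF P P P] by (simp add: simps)
  next
    fix x assume x: "x \<in> carrier (Aut_fus S F P)"
    then show "\<one>\<^bsub>Aut_fus S F P\<^esub> \<otimes>\<^bsub>Aut_fus S F P\<^esub> x = x"
      using F_id[OF P] F_sub[OF P P] Id_compose[of x P P] F_funcset[OF P P] by (auto simp: simps)
    obtain h where "h \<in> F P P" "compose P h x = (\<lambda>x \<in> P. x)"
      using F_self_iso[OF P] x by (auto simp: simps Iso_fus_def)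
    then show "\<exists>y \<in> carrier (Aut_fus S F P). y \<otimes>\<^bsub>Aut_fus S F P\<^esub> x = \<one>\<^bsub>Aut_fus S F P\<^esub>"
      using x by (auto simp: simps)
  qed
  moreover have "finite (F P P)"
  proof (rule finite_subset)
    show "F P P \<subseteq> P \<rightarrow>\<^sub>E P" using F_sub[OF P P] by (auto simp: hom_def PiE_def)
    show "finite (P \<rightarrow>\<^sub>E P)" using finite_subgroup[OF P] by (intro finite_PiE) auto
  qed
  ultimately show ?thesis by (simp add: finite_group_def finite_group_axioms_def simps)
qed

text \<open>Evaluating at \<open>\<beta> y\<close> cancels the inverse of \<beta>, so later
  computations never mention that inverse.\<close>

lemma Aut_fus_conjugation:
  assumes P: "subgroup P S" and \<alpha>: "\<alpha> \<in> F P P" and \<beta>: "\<beta> \<in> F P P" and y: "y \<in> P"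
  shows "conjugation (Aut_fus S F P) \<beta> \<alpha> (\<beta> y) = \<beta> (\<alpha> y)"
proof -
  interpret A: finite_group "Aut_fus S F P" by (rule Aut_fus_finite_group[OF P])
  note simps = Aut_fus_simps[OF P]
  let ?\<beta>' = "inv\<^bsub>Aut_fus S F P\<^esub> \<beta>"
  have \<beta>': "?\<beta>' \<in> F P P" using A.inv_closed[of \<beta>] \<beta> by (simp add: simps)
  have "compose P ?\<beta>' \<beta> = (\<lambda>x \<in> P. x)" using A.l_inv[of \<beta>] \<beta> \<beta>' by (simp add: simps)
  then have inv: "?\<beta>' (\<beta> y) = y" using y compose_eq[OF y, of ?\<beta>' \<beta>] by simp
  have "conjugation (Aut_fus S F P) \<beta> \<alpha> = compose P (compose P \<beta> \<alpha>) ?\<beta>'"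
    using \<alpha> \<beta> \<beta>' F_comp[OF P P P] by (simp add: conjugation_def simps)
  then show ?thesis
    using inv y F_funcset[OF P P \<beta> y] by (simp add: compose_eq)
qed

text \<open>Conjugation is injective and \<open>P\<close> finite, so carrying \<open>P\<close> into
  itself already means normalizing it.\<close>

lemma Hom_conj_iff:
  assumes P: "subgroup P S"
  shows "\<alpha> \<in> Hom_conj S P P \<longleftrightarrow> (\<exists>g \<in> normalizer S P. \<alpha> = restrict (conjugation S g) P)"
proof -
  have "conjugation S g ` P \<subseteq> P \<longleftrightarrow> g \<in> normalizer S P" if g: "g \<in> carrier S" for g
  proof -
    have "card (conjugation S g ` P) = card P"
      by (rule card_image[OF conjugation_inj_on[OF g subgroup.subset[OF P]]])
    then have "conjugation S g ` P \<subseteq> P \<longleftrightarrow> conjugation S g ` P = P"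
      using card_subset_eq[OF finite_subgroup[OF P]] by blast
    then show ?thesis using g normalizer_iff[OF subgroup.subset[OF P]] by simp
  qed
  moreover have "normalizer S P \<subseteq> carrier S"
    using normalizer_iff[OF subgroup.subset[OF P]] by blast
  ultimately show ?thesis unfolding Hom_conj_def by blast
qed

section \<open>Normalizers and the extension of morphisms\<close>

lemma normalizer_subgroup: "subgroup P S \<Longrightarrow> subgroup (normalizer S P) S"
  by (rule normalizer_imp_subgroup[OF subgroup.subset])

lemma normalizer_closed:
  assumes "subgroup P S" "g \<in> normalizer S P" "x \<in> P"
  shows "conjugation S g x \<in> P"
  using assms normalizer_iff[OF subgroup.subset[OF assms(1)]] by blast

lemma card_p_group:
  assumes "subgroup P S"
  obtains n where "card P = p ^ n"
proof -
  obtain m where "order S = p ^ m" using p_group by blast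
  then have "card P dvd p ^ m" using lagrange[OF assms] by (metis dvd_triv_right)
  then show ?thesis using that divides_primepow_nat[OF prime_p] by blast
qed

lemma normalizer_subset: "subgroup P S \<Longrightarrow> P \<noteq> carrier S \<Longrightarrow> P \<subset> normalizer S P"
  using p_group normalizer_grows[OF prime_p] by blast

text \<open>As \<open>f\<close> maps \<open>Q\<close> onto \<open>P\<close>, substituting
  \<open>f y\<close> for the argument removes \<open>inv_into\<close>. An intertwining
  \<open>s\<close> carries \<open>P\<close> into itself because \<open>g\<close> normalizes
  \<open>Q\<close>, so the right-hand side can let \<open>s\<close> range over all of
  \<open>S\<close>.\<close>

lemma N_ext_iff:
  assumes Q: "subgroup Q S" and P: "subgroup P S" and f: "f \<in> Iso_fus F Q P"
  shows "g \<in> N_ext S Q P f \<longleftrightarrow> g \<in> normalizer S Q \<and>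
    (\<exists>s \<in> carrier S. \<forall>y \<in> Q. f (conjugation S g y) = conjugation S s (f y))"
proof -
  have inj: "inj_on f Q" using F_sub[OF Q P Iso_F[OF f]] by blast
  have im: "f ` Q = P" by (rule Iso_image[OF Q P f])
  have inv: "inv_into Q f (f y) = y" if "y \<in> Q" for y using inj that by simp
  have eq: "(\<lambda>x \<in> P. f (conjugation S g (inv_into Q f x))) = restrict (conjugation S s) P \<longleftrightarrow>
      (\<forall>y \<in> Q. f (conjugation S g y) = conjugation S s (f y))" for s
  proof -
    have "(\<lambda>x \<in> P. f (conjugation S g (inv_into Q f x))) = restrict (conjugation S s) P \<longleftrightarrow>
      (\<forall>x \<in> P. f (conjugation S g (inv_into Q f x)) = conjugation S s x)"
      unfolding restrict_def fun_eq_iff by (meson)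
    also have "\<dots> \<longleftrightarrow> (\<forall>y \<in> Q. f (conjugation S g y) = conjugation S s (f y))"
      unfolding im[symmetric] by (simp add: inv)
    finally show ?thesis .
  qed
  have "conjugation S s ` P \<subseteq> P"
    if "g \<in> normalizer S Q" "\<forall>y \<in> Q. f (conjugation S g y) = conjugation S s (f y)" for s
  proof clarify
    fix x assume "x \<in> P"
    then obtain y where y: "y \<in> Q" "x = f y" using im by blast
    have "f (conjugation S g y) \<in> P"
      by (rule F_funcset[OF Q P Iso_F[OF f] normalizer_closed[OF Q that(1) y(1)]])
    then show "conjugation S s x \<in> P" using that(2) y by simp
  qed
  then show ?thesis unfolding N_ext_def Hom_conj_def mem_Collect_eq eq by blast
qed

text \<open>The intertwining elements multiply and invert along with \<open>g\<close>; for
  \<open>g\<close> in \<open>Q\<close> take \<open>f g\<close>.\<close>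

lemma N_ext_subgroup:
  assumes Q: "subgroup Q S" and P: "subgroup P S" and f: "f \<in> Iso_fus F Q P"
  shows "subgroup (N_ext S Q P f) S" "Q \<subseteq> N_ext S Q P f"
proof -
  note iff = N_ext_iff[OF assms] and N = normalizer_subgroup[OF Q]
  have fP: "f y \<in> carrier S" if "y \<in> Q" for y
    using F_funcset[OF Q P Iso_F[OF f] that] subgroup.mem_carrier[OF P] by blast
  have QS: "y \<in> carrier S" if "y \<in> Q" for y using that subgroup.mem_carrier[OF Q] by blast
  show sub: "Q \<subseteq> N_ext S Q P f"
  proof
    fix g assume g: "g \<in> Q"
    have c: "conjugation S g ` Q \<subseteq> Q"
      using g subgroup.m_closed[OF Q] subgroup.m_inv_closed[OF Q] by (auto simp: conjugation_def)
    have "card (conjugation S g ` Q) = card Q"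
      by (rule card_image[OF conjugation_inj_on[OF QS[OF g] subgroup.subset[OF Q]]])
    then have "conjugation S g ` Q = Q"
      by (rule card_subset_eq[OF finite_subgroup[OF Q] c])
    then have "g \<in> normalizer S Q"
      using normalizer_iff[OF subgroup.subset[OF Q]] QS[OF g] by simp
    then show "g \<in> N_ext S Q P f"
      unfolding iff using fP[OF g] F_conjugation[OF Q P Iso_F[OF f] g] by blast
  qed
  show "subgroup (N_ext S Q P f) S"
  proof (rule subgroupI)
    show "N_ext S Q P f \<subseteq> carrier S"
      using iff subgroup.subset[OF N] by blast
    show "N_ext S Q P f \<noteq> {}" using sub subgroup.one_closed[OF Q] by blast
  next
    fix g assume "g \<in> N_ext S Q P f"
    then obtain s where g: "g \<in> normalizer S Q" and s: "s \<in> carrier S"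
      "\<And>y. y \<in> Q \<Longrightarrow> f (conjugation S g y) = conjugation S s (f y)"
      unfolding iff by blast
    have gS: "g \<in> carrier S" and g': "inv g \<in> normalizer S Q"
      using g subgroup.mem_carrier[OF N] subgroup.m_inv_closed[OF N] by blast+
    have "f (conjugation S (inv g) y) = conjugation S (inv s) (f y)" if y: "y \<in> Q" for y
    proof -
      have y': "conjugation S (inv g) y \<in> Q" by (rule normalizer_closed[OF Q g' y])
      have "f y = conjugation S s (f (conjugation S (inv g) y))"
        using s(2)[OF y'] gS QS[OF y] by simp
      then show ?thesis using s(1) fP[OF y'] by simp
    qed
    then show "inv g \<in> N_ext S Q P f" unfolding iff using g' s(1) by blast
  next
    fix g h assume "g \<in> N_ext S Q P f" "h \<in> N_ext S Q P f"
    then obtain s t where g: "g \<in> normalizer S Q" and s: "s \<in> carrier S"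
      "\<And>y. y \<in> Q \<Longrightarrow> f (conjugation S g y) = conjugation S s (f y)"
      and h: "h \<in> normalizer S Q" and t: "t \<in> carrier S"
      "\<And>y. y \<in> Q \<Longrightarrow> f (conjugation S h y) = conjugation S t (f y)"
      unfolding iff by blast
    have "f (conjugation S (g \<otimes> h) y) = conjugation S (s \<otimes> t) (f y)" if y: "y \<in> Q" for y
      using s(1) t(1) s(2)[OF normalizer_closed[OF Q h y]] t(2)[OF y] fP[OF y] QS[OF y]
        subgroup.mem_carrier[OF N] g h
      by (simp flip: conjugation_comp)
    then show "g \<otimes> h \<in> N_ext S Q P f"
      unfolding iff using s(1) t(1) subgroup.m_closed[OF N g h] by blast
  qed
qed

text \<open>Conjugation by \<open>g\<close> is carried to \<open>P\<close> along \<open>f\<close>.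
  Being a homomorphism, \<theta> maps the normalizer onto a \<open>p\<close>-subgroup of
  \<open>Aut_fus S F P\<close>, to which Sylow conjugacy applies.\<close>

lemma transported_conjugation:
  assumes Q: "subgroup Q S" and P: "subgroup P S" and f: "f \<in> Iso_fus F Q P"
  defines "\<theta> \<equiv> \<lambda>g. \<lambda>x \<in> P. f (conjugation S g (inv_into Q f x))"
  shows "group_hom (S\<lparr>carrier := normalizer S Q\<rparr>) (Aut_fus S F P) \<theta>"
    and "y \<in> Q \<Longrightarrow> \<theta> g (f y) = f (conjugation S g y)"
proof -
  note N = normalizer_subgroup[OF Q] and simps = Aut_fus_simps[OF P]
  interpret A: finite_group "Aut_fus S F P" by (rule Aut_fus_finite_group[OF P])
  interpret N: group "S\<lparr>carrier := normalizer S Q\<rparr>" by (rule subgroup_imp_group[OF N])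
  obtain h where h: "h \<in> Iso_fus F P Q" "\<And>x. x \<in> Q \<Longrightarrow> h (f x) = x" "\<And>x. x \<in> P \<Longrightarrow> f (h x) = x"
    using Iso_inverse[OF Q P f] by metis
  have inj: "inj_on f Q" using F_sub[OF Q P Iso_F[OF f]] by blast
  have hQ: "h x \<in> Q" if "x \<in> P" for x by (rule F_funcset[OF P Q Iso_F[OF h(1)] that])
  have fP: "f x \<in> P" if "x \<in> Q" for x by (rule F_funcset[OF Q P Iso_F[OF f] that])
  have inv: "inv_into Q f x = h x" if "x \<in> P" for x
    using inv_into_f_f[OF inj hQ[OF that]] h(3)[OF that] by simp
  have \<theta>: "\<theta> g x = f (conjugation S g (h x))" if "x \<in> P" for g x
    using that inv by (simp add: \<theta>_def)
  show app: "\<theta> g (f y) = f (conjugation S g y)" if "y \<in> Q" for g y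
    using \<theta>[OF fP[OF that]] h(2)[OF that] by simp
  have F: "\<theta> g \<in> F P P" if g: "g \<in> normalizer S Q" for g
  proof -
    have "restrict (conjugation S g) Q \<in> Hom_conj S Q Q" using Hom_conj_iff[OF Q] g by blast
    then have c: "restrict (conjugation S g) Q \<in> F Q Q" using F_conj[OF Q Q] by blast
    have "compose P (compose Q f (restrict (conjugation S g) Q)) h \<in> F P P"
      by (rule F_comp[OF P Q P Iso_F[OF h(1)] F_comp[OF Q Q P c Iso_F[OF f]]])
    moreover have "compose P (compose Q f (restrict (conjugation S g) Q)) h = \<theta> g"
      by (rule ext) (auto simp: compose_def restrict_def \<theta> hQ, simp add: \<theta>_def)
    ultimately show ?thesis by simp
  qed
  have "\<theta> (g \<otimes> g') = compose P (\<theta> g) (\<theta> g')"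
    if g: "g \<in> normalizer S Q" "g' \<in> normalizer S Q" for g g'
  proof (rule extensionalityI[of _ P])
    show "\<theta> (g \<otimes> g') \<in> extensional P" by (simp add: \<theta>_def)
    show "compose P (\<theta> g) (\<theta> g') \<in> extensional P" by simp
    fix x assume x: "x \<in> P"
    have "compose P (\<theta> g) (\<theta> g') x = \<theta> g (f (conjugation S g' (h x)))"
      using x by (simp add: compose_eq \<theta>)
    also have "\<dots> = f (conjugation S g (conjugation S g' (h x)))"
      by (rule app[OF normalizer_closed[OF Q g(2) hQ[OF x]]])
    also have "\<dots> = \<theta> (g \<otimes> g') x"
      using g subgroup.mem_carrier[OF N] subgroup.mem_carrier[OF Q hQ[OF x]]
      by (simp add: \<theta>[OF x] conjugation_comp)
    finally show "\<theta> (g \<otimes> g') x = compose P (\<theta> g) (\<theta> g') x" by simp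
  qed
  then show "group_hom (S\<lparr>carrier := normalizer S Q\<rparr>) (Aut_fus S F P) \<theta>"
    using F by unfold_locales (auto simp: hom_def simps)
qed

text \<open>Along any isomorphism to \<open>P\<close>, Aut_S(Q) becomes a \<open>p\<close>-subgroup
  of Aut_F(P), and some \<alpha> conjugates it into the Sylow subgroup Aut_S(P). Following the
  isomorphism by \<alpha> enlarges \<open>N_ext\<close> to the whole normalizer, where receptivity
  provides the extension. The given isomorphism is replaced in the process, so only existence is
  claimed.\<close>

lemma extend_to_normalizer:
  assumes P: "subgroup P S" "fully_automized p S F P" "receptive S F P"
    and Q: "subgroup Q S" "fus_conj F Q P"
  obtains f h where "f \<in> Iso_fus F Q P" "h \<in> F (normalizer S Q) (carrier S)"
    "\<And>x. x \<in> Q \<Longrightarrow> h x = f x"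
proof -
  note N = normalizer_subgroup[OF Q(1)] and simps = Aut_fus_simps[OF P(1)]
  interpret A: finite_group "Aut_fus S F P" by (rule Aut_fus_finite_group[OF P(1)])
  obtain f where f: "f \<in> Iso_fus F Q P" using Q(2) by (auto simp: fus_conj_def)
  define \<theta> where "\<theta> = (\<lambda>g. \<lambda>x \<in> P. f (conjugation S g (inv_into Q f x)))"
  have hom: "group_hom (S\<lparr>carrier := normalizer S Q\<rparr>) (Aut_fus S F P) \<theta>"
    and \<theta>: "\<And>y g. y \<in> Q \<Longrightarrow> \<theta> g (f y) = f (conjugation S g y)"
    unfolding \<theta>_def using transported_conjugation[OF Q(1) P(1) f] by blast+
  interpret \<theta>: group_hom "S\<lparr>carrier := normalizer S Q\<rparr>" "Aut_fus S F P" \<theta> by (rule hom)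
  let ?K = "\<theta> ` normalizer S Q"
  have K: "subgroup ?K (Aut_fus S F P)" using \<theta>.img_is_subgroup by simp
  obtain n where n: "card (normalizer S Q) = p ^ n" using card_p_group[OF N] .
  have "card ?K dvd p ^ n"
    using \<theta>.card_image_dvd finite_subgroup[OF N] n by (simp add: order_def)
  then obtain m where m: "card ?K = p ^ m" using divides_primepow_nat[OF prime_p] by blast
  obtain \<alpha> where \<alpha>: "\<alpha> \<in> F P P" "conjugation (Aut_fus S F P) \<alpha> ` ?K \<subseteq> Hom_conj S P P"
    using A.sylow_conjugate[OF prime_p _ K m] P(2) by (auto simp: fully_automized_def simps)
  let ?f = "compose Q \<alpha> f"
  have f': "?f \<in> Iso_fus F Q P"
    by (rule Iso_compose[OF Q(1) P(1) P(1) f F_self_iso[OF P(1) \<alpha>(1)]])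
  have "N_ext S Q P ?f = normalizer S Q"
  proof (intro equalityI subsetI)
    fix g assume g: "g \<in> normalizer S Q"
    have \<theta>F: "\<theta> g \<in> F P P" using \<theta>.hom_closed[of g] g by (simp add: simps)
    have "conjugation (Aut_fus S F P) \<alpha> (\<theta> g) \<in> Hom_conj S P P" using \<alpha>(2) g by blast
    then obtain s where s: "s \<in> carrier S"
      "conjugation (Aut_fus S F P) \<alpha> (\<theta> g) = restrict (conjugation S s) P"
      by (auto simp: Hom_conj_def)
    have "?f (conjugation S g y) = conjugation S s (?f y)" if y: "y \<in> Q" for y
    proof -
      have fy: "f y \<in> P" by (rule F_funcset[OF Q(1) P(1) Iso_F[OF f] y])
      have "?f (conjugation S g y) = \<alpha> (\<theta> g (f y))"
        using normalizer_closed[OF Q(1) g y] by (simp add: compose_eq \<theta>[OF y])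
      also have "\<dots> = conjugation (Aut_fus S F P) \<alpha> (\<theta> g) (\<alpha> (f y))"
        by (rule Aut_fus_conjugation[OF P(1) \<theta>F \<alpha>(1) fy, symmetric])
      also have "\<dots> = conjugation S s (?f y)"
        using F_funcset[OF P(1) P(1) \<alpha>(1) fy] y by (simp add: s(2) compose_eq)
      finally show ?thesis .
    qed
    then show "g \<in> N_ext S Q P ?f" unfolding N_ext_iff[OF Q(1) P(1) f'] using g s(1) by blast
  qed (simp add: N_ext_def)
  moreover obtain h where "h \<in> F (N_ext S Q P ?f) (carrier S)" "\<forall>x \<in> Q. h x = ?f x"
    using P(3) Q(1) f' unfolding receptive_def by blast
  ultimately show ?thesis using that[OF f'] by auto
qed

text \<open>The extension to \<open>normalizer S Q\<close> is injective and carries \<open>Q\<close>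
  to \<open>P\<close>, hence the normalizer of \<open>Q\<close> into that of
  \<open>P\<close>.\<close>

lemma fully_normalizedI:
  assumes P: "subgroup P S" "fully_automized p S F P" "receptive S F P"
  shows "fully_normalized S F P"
  unfolding fully_normalized_def
proof (intro allI impI)
  fix Q assume "subgroup Q S \<and> fus_conj F P Q"
  then have Q: "subgroup Q S" "fus_conj F Q P" using fus_conj_sym[OF P(1)] by blast+
  note N = normalizer_subgroup[OF Q(1)]
  obtain f h where f: "f \<in> Iso_fus F Q P" and h: "h \<in> F (normalizer S Q) (carrier S)"
    and hf: "\<And>x. x \<in> Q \<Longrightarrow> h x = f x" using extend_to_normalizer[OF P Q] by metis
  have QN: "Q \<subseteq> normalizer S Q" using N_ext_subgroup(2)[OF Q(1) P(1) f] by (auto simp: N_ext_def)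
  have hQ: "h ` Q = P" using hf Iso_image[OF Q(1) P(1) f] by auto
  have "h ` normalizer S Q \<subseteq> normalizer S P"
  proof clarify
    fix g assume g: "g \<in> normalizer S Q"
    have hg: "h g \<in> carrier S" by (rule F_funcset[OF N subgroup_self h g])
    have "conjugation S (h g) ` P = (\<lambda>x. conjugation S (h g) (h x)) ` Q"
      unfolding hQ[symmetric] by (rule image_image)
    also have "\<dots> = (\<lambda>x. h (conjugation S g x)) ` Q"
      using F_conjugation[OF N subgroup_self h g] QN by (intro image_cong) auto
    also have "\<dots> = h ` conjugation S g ` Q" by (rule image_image[symmetric])
    also have "\<dots> = P" using g normalizer_iff[OF subgroup.subset[OF Q(1)]] hQ by simp
    finally show "h g \<in> normalizer S P"
      using hg normalizer_iff[OF subgroup.subset[OF P(1)]] by simp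
  qed
  moreover have "inj_on h (normalizer S Q)" using F_sub[OF N subgroup_self h] by blast
  ultimately show "card (normalizer S Q) \<le> card (normalizer S P)"
    using finite_subgroup[OF normalizer_subgroup[OF P(1)]] card_inj_on_le by blast
qed

lemma centralizer_normalizer:
  assumes "subgroup Q S" "c \<in> centralizer S Q"
  shows "c \<in> normalizer S Q" "x \<in> Q \<Longrightarrow> conjugation S c x = x"
proof -
  have c: "c \<in> carrier S" "\<And>x. x \<in> Q \<Longrightarrow> c \<otimes> x = x \<otimes> c"
    using assms(2) by (auto simp: centralizer_def)
  show eq: "conjugation S c x = x" if "x \<in> Q" for x
    using c that subgroup.mem_carrier[OF assms(1) that] by (simp add: conjugation_def m_assoc)
  show "c \<in> normalizer S Q"
    using c(1) eq by (simp add: normalizer_iff[OF subgroup.subset[OF assms(1)]])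
qed

text \<open>The extension is defined on \<open>centralizer S Q\<close> and carries it into
  \<open>centralizer S P\<close>, which lies in \<open>P\<close>, the image of \<open>Q\<close>;
  injectivity brings it back into \<open>Q\<close>.\<close>

lemma fus_centricI:
  assumes P: "subgroup P S" "fully_automized p S F P" "receptive S F P"
    and C: "centralizer S P \<subseteq> P"
  shows "fus_centric S F P"
  unfolding fus_centric_def
proof (intro allI impI subsetI)
  fix Q c assume "subgroup Q S \<and> fus_conj F P Q" and c: "c \<in> centralizer S Q"
  then have Q: "subgroup Q S" "fus_conj F Q P" using fus_conj_sym[OF P(1)] by blast+
  note N = normalizer_subgroup[OF Q(1)]
  obtain f h where f: "f \<in> Iso_fus F Q P" and h: "h \<in> F (normalizer S Q) (carrier S)"
    and hf: "\<And>x. x \<in> Q \<Longrightarrow> h x = f x" using extend_to_normalizer[OF P Q] by metis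
  have QN: "Q \<subseteq> normalizer S Q" using N_ext_subgroup(2)[OF Q(1) P(1) f] by (auto simp: N_ext_def)
  have hQ: "h ` Q = P" using hf Iso_image[OF Q(1) P(1) f] by auto
  note cN = centralizer_normalizer(1)[OF Q(1) c]
  have cx: "c \<otimes> x = x \<otimes> c" if "x \<in> Q" for x using c that by (auto simp: centralizer_def)
  have "h c \<otimes> h x = h x \<otimes> h c" if x: "x \<in> Q" for x
    using F_mult[OF N subgroup_self h] cN QN x cx[OF x] by (metis subsetD)
  then have "h c \<in> centralizer S P"
    using F_funcset[OF N subgroup_self h cN] unfolding centralizer_def hQ[symmetric] by blast
  then have "h c \<in> h ` Q" using C hQ by blast
  then obtain x where "x \<in> Q" "h c = h x" by blast
  moreover have "inj_on h (normalizer S Q)" using F_sub[OF N subgroup_self h] by blast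
  ultimately show "c \<in> Q" using cN QN by (metis inj_onD subsetD)
qed

section \<open>Inner automorphisms inside Aut_F(R)\<close>

lemma Inn_subgroup_eq:
  assumes R: "subgroup R S"
  shows "Inn (S\<lparr>carrier := R\<rparr>) = (\<lambda>g. restrict (conjugation S g) R) ` R"
proof -
  have "restrict (conjugation (S\<lparr>carrier := R\<rparr>) g) R = restrict (conjugation S g) R" if "g \<in> R" for g
    by (rule restrict_ext) (simp add: conjugation_def m_inv_consistent[OF R that])
  then have "(\<lambda>g. restrict (conjugation (S\<lparr>carrier := R\<rparr>) g) R) ` R
      = (\<lambda>g. restrict (conjugation S g) R) ` R" by (rule image_cong[OF refl])
  then show ?thesis by (simp add: Inn_def setcompr_eq_image)
qed

end

context fusion_system
begin

lemma subset_normalizer: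
  assumes R: "subgroup R S"
  shows "R \<subseteq> normalizer S R"
  using N_ext_subgroup(2)[OF R R F_self_iso[OF R F_id[OF R]]] by (auto simp: N_ext_def)

lemma conjugation_hom_Aut_fus:
  assumes R: "subgroup R S"
  shows "group_hom (S\<lparr>carrier := R\<rparr>) (Aut_fus S F R) (\<lambda>g. restrict (conjugation S g) R)"
proof -
  interpret A: finite_group "Aut_fus S F R" by (rule Aut_fus_finite_group[OF R])
  interpret RG: group "S\<lparr>carrier := R\<rparr>" by (rule subgroup_imp_group[OF R])
  note simps = Aut_fus_simps[OF R]
  let ?c = "\<lambda>g. restrict (conjugation S g) R"
  have RS: "x \<in> carrier S" if "x \<in> R" for x using that subgroup.mem_carrier[OF R] by blast
  have cF: "?c g \<in> F R R" if "g \<in> R" for g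
    using Hom_conj_iff[OF R] F_conj[OF R R] subset_normalizer[OF R] that by blast
  have cR: "conjugation S g x \<in> R" if "g \<in> R" "x \<in> R" for g x
    using normalizer_closed[OF R _ that(2)] subset_normalizer[OF R] that(1) by blast
  have "?c (g \<otimes> h) = ?c g \<otimes>\<^bsub>Aut_fus S F R\<^esub> ?c h" if gh: "g \<in> R" "h \<in> R" for g h
  proof -
    have "?c g \<otimes>\<^bsub>Aut_fus S F R\<^esub> ?c h = compose R (?c g) (?c h)"
      by (rule simps(3)[OF cF[OF gh(1)] cF[OF gh(2)]])
    moreover have "?c (g \<otimes> h) = compose R (?c g) (?c h)"
      unfolding compose_def
      by (rule restrict_ext) (use gh cR RS in \<open>simp add: conjugation_comp\<close>)
    ultimately show ?thesis by simp
  qed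
  then show ?thesis using cF by unfold_locales (auto simp: hom_def simps)
qed

lemma Inn_card_p:
  assumes R: "subgroup R S"
  obtains n where "card (Inn (S\<lparr>carrier := R\<rparr>)) = p ^ n"
proof -
  have "card (Inn (S\<lparr>carrier := R\<rparr>)) dvd card R"
    using group_hom.card_image_dvd[OF conjugation_hom_Aut_fus[OF R]] finite_subgroup[OF R]
    by (simp add: order_def Inn_subgroup_eq[OF R])
  moreover obtain n where "card R = p ^ n" using card_p_group[OF R] .
  ultimately show ?thesis using that divides_primepow_nat[OF prime_p] by auto
qed

text \<open>The element of \<open>S\<close> that realizes the conjugated automorphism is the
  intertwining element asked for by \<open>N_ext_iff\<close>.\<close>

lemma Aut_fus_conjugation_Hom_conj:
  assumes R: "subgroup R S" and \<beta>: "\<beta> \<in> F R R" and g: "g \<in> normalizer S R"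
    and conj: "conjugation (Aut_fus S F R) \<beta> (restrict (conjugation S g) R) \<in> Hom_conj S R R"
  shows "g \<in> N_ext S R R \<beta>"
proof -
  have c: "restrict (conjugation S g) R \<in> F R R"
    using Hom_conj_iff[OF R] F_conj[OF R R] g by blast
  obtain s where s: "s \<in> carrier S"
    "conjugation (Aut_fus S F R) \<beta> (restrict (conjugation S g) R) = restrict (conjugation S s) R"
    using conj by (auto simp: Hom_conj_def)
  have "\<beta> (conjugation S g y) = conjugation S s (\<beta> y)" if y: "y \<in> R" for y
    using Aut_fus_conjugation[OF R c \<beta> y] y F_funcset[OF R R \<beta> y] by (simp add: s(2))
  then show ?thesis unfolding N_ext_iff[OF R R F_self_iso[OF R \<beta>]] using g s(1) by blast
qed

text \<open>Conjugating by \<beta> turns conjugation by \<open>r\<close> into conjugation by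
  \<open>\<beta> r\<close>, again an element of \<open>R\<close>.\<close>

lemma Inn_normal_Aut_fus:
  assumes R: "subgroup R S"
  shows "Inn (S\<lparr>carrier := R\<rparr>) \<lhd> Aut_fus S F R"
proof -
  interpret A: finite_group "Aut_fus S F R" by (rule Aut_fus_finite_group[OF R])
  note simps = Aut_fus_simps[OF R]
  define c where "c g = restrict (conjugation S g) R" for g
  have Inn: "Inn (S\<lparr>carrier := R\<rparr>) = c ` R" unfolding c_def by (rule Inn_subgroup_eq[OF R])
  interpret c: group_hom "S\<lparr>carrier := R\<rparr>" "Aut_fus S F R" c
    unfolding c_def by (rule conjugation_hom_Aut_fus[OF R])
  have sub: "subgroup (c ` R) (Aut_fus S F R)" using c.img_is_subgroup by simp
  have cF: "c g \<in> F R R" if "g \<in> R" for g using c.hom_closed[of g] that by (simp add: simps)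
  show ?thesis
    unfolding Inn
  proof (rule A.normal_invI[OF sub])
    fix \<beta> \<iota> assume "\<beta> \<in> carrier (Aut_fus S F R)" "\<iota> \<in> c ` R"
    then obtain r where \<beta>: "\<beta> \<in> F R R" and r: "r \<in> R" "\<iota> = c r" by (auto simp: simps)
    have "conjugation (Aut_fus S F R) \<beta> \<iota> = c (\<beta> r)"
    proof (rule extensionalityI[of _ R])
      have "conjugation (Aut_fus S F R) \<beta> \<iota> \<in> F R R"
        using A.conjugation_closed[of \<beta> \<iota>] \<beta> cF[OF r(1)] r(2) by (simp add: simps)
      then show "conjugation (Aut_fus S F R) \<beta> \<iota> \<in> extensional R" using F_sub[OF R R] by blast
      show "c (\<beta> r) \<in> extensional R" by (simp add: c_def)
      fix x assume "x \<in> R"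
      then obtain y where y: "y \<in> R" "x = \<beta> y"
        using Iso_image[OF R R F_self_iso[OF R \<beta>]] by blast
      have "conjugation (Aut_fus S F R) \<beta> \<iota> x = \<beta> (conjugation S r y)"
        using Aut_fus_conjugation[OF R cF[OF r(1)] \<beta> y(1)] y by (simp add: r(2)) (simp add: c_def)
      also have "\<dots> = c (\<beta> r) x"
        using F_conjugation[OF R R \<beta> r(1) y(1)] F_funcset[OF R R \<beta> y(1)] by (simp add: y(2) c_def)
      finally show "conjugation (Aut_fus S F R) \<beta> \<iota> x = c (\<beta> r) x" .
    qed
    then show "\<beta> \<otimes>\<^bsub>Aut_fus S F R\<^esub> \<iota> \<otimes>\<^bsub>Aut_fus S F R\<^esub> inv\<^bsub>Aut_fus S F R\<^esub> \<beta> \<in> c ` R"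
      using F_funcset[OF R R \<beta> r(1)] by (simp add: conjugation_def)
  qed
qed

end

section \<open>The fusion theorem\<close>

text \<open>
  Isomorphisms with this property are closed under composition, inversion and restriction, so in
  the fusion theorem it replaces an explicit decomposition of a morphism.
\<close>

definition preserves :: "('a, 'm) monoid_scheme \<Rightarrow> ('a set \<Rightarrow> 'b) \<Rightarrow> 'a set \<Rightarrow> ('a \<Rightarrow> 'a) \<Rightarrow> bool" where
  "preserves S u P f \<longleftrightarrow> (\<forall>A. subgroup A S \<and> A \<subseteq> P \<longrightarrow> u (f ` A) = u A)"

text \<open>Values of \<open>u\<close> are only compared for equality; the marks of a unit are the
  intended instance. Invariance is assumed at the subgroups indexing the second
  intersection.\<close>

locale essential_invariant = saturated_fusion_system p S F
  for p :: nat and S (structure) and F :: "'a fusion" +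
  fixes u :: "'a set \<Rightarrow> 'c"
  assumes invariant: "\<lbrakk>subgroup R S; R = carrier S \<or> essential p S F R; \<alpha> \<in> F R R\<rbrakk>
    \<Longrightarrow> preserves S u R \<alpha>"
begin

text \<open>The induction hypothesis of \<open>preserves_fusion\<close>. It depends on an order
  only, so it passes between conjugate subgroups.\<close>

definition preserves_above :: "nat \<Rightarrow> bool" where
  "preserves_above n \<longleftrightarrow> (\<forall>N Q f. subgroup N S \<and> subgroup Q S \<and> n < card N \<and>
     f \<in> Iso_fus F N Q \<longrightarrow> preserves S u N f)"

text \<open>Conjugation by an element of \<open>S\<close> is the restriction of an automorphism of
  \<open>S\<close> itself, where invariance is assumed.\<close>

lemma preserves_conjugation:
  assumes R: "subgroup R S" and c: "c \<in> Hom_conj S R R"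
  shows "preserves S u R c"
proof -
  obtain g where g: "g \<in> carrier S" "c = restrict (conjugation S g) R"
    using c by (auto simp: Hom_conj_def)
  have "restrict (conjugation S g) (carrier S) \<in> Hom_conj S (carrier S) (carrier S)"
    using g(1) by (auto simp: Hom_conj_def)
  then have "restrict (conjugation S g) (carrier S) \<in> F (carrier S) (carrier S)"
    using F_conj[OF subgroup_self subgroup_self] by blast
  then have *: "preserves S u (carrier S) (restrict (conjugation S g) (carrier S))"
    using invariant[OF subgroup_self] by blast
  show ?thesis
    unfolding preserves_def
  proof (intro allI impI)
    fix A assume A: "subgroup A S \<and> A \<subseteq> R"
    then have AS: "A \<subseteq> carrier S" using subgroup.subset by blast
    have "c ` A = conjugation S g ` A"
      using A by (intro image_cong) (auto simp: g(2))
    also have "\<dots> = restrict (conjugation S g) (carrier S) ` A"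
      using AS by (intro image_cong) auto
    also have "u \<dots> = u A" using * A AS unfolding preserves_def by blast
    finally show "u (c ` A) = u A" .
  qed
qed

text \<open>The extension is an isomorphism onto its image from a group of larger order, so the
  induction hypothesis covers it.\<close>

lemma preserves_extension:
  assumes IH: "preserves_above (card P)"
    and N: "subgroup N S" "P \<subset> N" and h: "h \<in> F N (carrier S)" "\<And>x. x \<in> P \<Longrightarrow> h x = f x"
  shows "preserves S u P f"
proof -
  have "card P < card N" by (rule psubset_card_mono[OF finite_subgroup[OF N(1)] N(2)])
  then have *: "preserves S u N h"
    using IH N(1) F_onto_image[OF N(1) subgroup_self h(1)] unfolding preserves_above_def by blast
  show ?thesis
    unfolding preserves_def
  proof (intro allI impI)
    fix A assume A: "subgroup A S \<and> A \<subseteq> P"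
    have "f ` A = h ` A" using A h(2) by (intro image_cong) auto
    moreover have "A \<subseteq> N" using A N(2) by blast
    ultimately show "u (f ` A) = u A" using * A by (simp add: preserves_def)
  qed
qed

text \<open>One element \<open>g\<close> outside \<open>R\<close> suffices: \<open>N_ext\<close> is
  then strictly larger than \<open>R\<close>, and receptivity extends \<beta> to it.\<close>

lemma preserves_receptive_aut:
  assumes IH: "preserves_above (card R)"
    and R: "subgroup R S" "receptive S F R"
    and \<beta>: "\<beta> \<in> F R R" and g: "g \<in> N_ext S R R \<beta>" "g \<notin> R"
  shows "preserves S u R \<beta>"
proof -
  note \<beta>I = F_self_iso[OF R(1) \<beta>]
  obtain h where h: "h \<in> F (N_ext S R R \<beta>) (carrier S)" "\<forall>x \<in> R. h x = \<beta> x"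
    using R \<beta>I unfolding receptive_def by blast
  have "R \<subset> N_ext S R R \<beta>" using N_ext_subgroup(2)[OF R(1) R(1) \<beta>I] g by blast
  then show ?thesis
    using preserves_extension[OF IH N_ext_subgroup(1)[OF R(1) R(1) \<beta>I] _ h(1)] h(2) by blast
qed

text \<open>Automorphisms of \<open>R\<close> permute its subgroups, so invariance can be applied at
  an image. The image of this subgroup in Out_F(R) is the candidate for strong embedding.\<close>

lemma preserving_subgroup:
  assumes R: "subgroup R S"
  shows "subgroup {\<alpha> \<in> F R R. preserves S u R \<alpha>} (Aut_fus S F R)"
proof -
  interpret A: finite_group "Aut_fus S F R" by (rule Aut_fus_finite_group[OF R])
  note simps = Aut_fus_simps[OF R]
  have img: "subgroup (\<alpha> ` A) S \<and> \<alpha> ` A \<subseteq> R" if "\<alpha> \<in> F R R" "subgroup A S" "A \<subseteq> R" for \<alpha> A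
    using F_image_subgroup[OF R R that] F_funcset[OF R R that(1)] that(3) by blast
  show ?thesis
  proof (rule A.subgroupI)
    show "{\<alpha> \<in> F R R. preserves S u R \<alpha>} \<subseteq> carrier (Aut_fus S F R)" by (auto simp: simps)
    have "(\<lambda>x \<in> R. x) ` A = A" if "A \<subseteq> R" for A using that by (auto simp: image_iff subset_iff)
    then have "preserves S u R (\<lambda>x \<in> R. x)" by (simp add: preserves_def)
    then show "{\<alpha> \<in> F R R. preserves S u R \<alpha>} \<noteq> {}" using F_id[OF R] by blast
  next
    fix \<alpha> assume "\<alpha> \<in> {\<alpha> \<in> F R R. preserves S u R \<alpha>}"
    then have \<alpha>: "\<alpha> \<in> F R R" "preserves S u R \<alpha>" by auto
    let ?i = "inv\<^bsub>Aut_fus S F R\<^esub> \<alpha>"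
    have i: "?i \<in> F R R" using A.inv_closed[of \<alpha>] \<alpha> by (simp add: simps)
    have "compose R \<alpha> ?i = (\<lambda>x \<in> R. x)" using A.r_inv[of \<alpha>] \<alpha> i by (simp add: simps)
    then have inv: "\<alpha> (?i y) = y" if "y \<in> R" for y using compose_eq[OF that, of \<alpha> ?i] that by simp
    have "u (?i ` A) = u A" if A: "subgroup A S" "A \<subseteq> R" for A
    proof -
      have "\<alpha> ` ?i ` A = A" using inv A(2) by (force simp: image_image subset_iff)
      then show ?thesis using \<alpha>(2) img[OF i A] unfolding preserves_def by metis
    qed
    then show "?i \<in> {\<alpha> \<in> F R R. preserves S u R \<alpha>}" using i by (simp add: preserves_def)
  next
    fix \<alpha> \<beta> assume "\<alpha> \<in> {\<alpha> \<in> F R R. preserves S u R \<alpha>}" "\<beta> \<in> {\<alpha> \<in> F R R. preserves S u R \<alpha>}"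
    then have \<alpha>: "\<alpha> \<in> F R R" "preserves S u R \<alpha>" and \<beta>: "\<beta> \<in> F R R" "preserves S u R \<beta>" by auto
    have "u (compose R \<alpha> \<beta> ` A) = u A" if A: "subgroup A S" "A \<subseteq> R" for A
    proof -
      have "compose R \<alpha> \<beta> ` A = (\<lambda>x. \<alpha> (\<beta> x)) ` A"
        using A(2) by (intro image_cong) (auto simp: compose_eq)
      then have "compose R \<alpha> \<beta> ` A = \<alpha> ` \<beta> ` A" by (simp add: image_image)
      then show ?thesis using \<alpha>(2) \<beta>(2) img[OF \<beta>(1) A] A by (simp add: preserves_def)
    qed
    then show "\<alpha> \<otimes>\<^bsub>Aut_fus S F R\<^esub> \<beta> \<in> {\<alpha> \<in> F R R. preserves S u R \<alpha>}"
      using F_comp[OF R R R \<beta>(1) \<alpha>(1)] \<alpha> \<beta> by (simp add: simps preserves_def)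
  qed
qed

text \<open>
  The automorphisms that preserve \<open>u\<close> include \<open>Aut\<^sub>S(R)\<close> and, by receptivity, everything that
  conjugates a \<open>p\<close>-subgroup of \<open>Aut\<^sub>S(R)\<close> larger than \<open>Inn(R)\<close> into \<open>Aut\<^sub>S(R)\<close>.  Unless they are
  all of \<open>Aut\<^sub>F(R)\<close>, their image in \<open>Out\<^sub>F(R)\<close> is therefore strongly embedded.
\<close>

lemma strongly_embedded_preserving:
  assumes IH: "preserves_above (card R)"
    and R: "subgroup R S" "fully_automized p S F R" "receptive S F R" "R \<noteq> carrier S"
    and C: "centralizer S R \<subseteq> R"
    and ne: "{\<alpha> \<in> F R R. preserves S u R \<alpha>} \<noteq> F R R"
  shows "\<exists>H. strongly_embedded p (Out_fus S F R) H"
proof -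
  let ?A = "Aut_fus S F R" and ?N = "Inn (S\<lparr>carrier := R\<rparr>)" and ?T = "Hom_conj S R R"
  let ?H = "{\<alpha> \<in> F R R. preserves S u R \<alpha>}"
  interpret A: finite_group ?A by (rule Aut_fus_finite_group[OF R(1)])
  note simps = Aut_fus_simps[OF R(1)]
  have H: "subgroup ?H ?A" by (rule preserving_subgroup[OF R(1)])
  have syl: "Sylow_subgroup p ?A ?T" using R(2) by (simp add: fully_automized_def)
  have T: "subgroup ?T ?A" and cT: "card ?T = p ^ multiplicity p (order ?A)"
    using syl by (auto simp: Sylow_subgroup_def)
  have TH: "?T \<subseteq> ?H"
    using preserves_conjugation[OF R(1)] F_conj[OF R(1) R(1)] by blast
  have RN: "R \<subset> normalizer S R" by (rule normalizer_subset[OF R(1,4)])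
  have NT: "?N \<subseteq> ?T"
    unfolding Inn_subgroup_eq[OF R(1)] using RN Hom_conj_iff[OF R(1)] by blast
  \<comment> \<open>If \<open>g\<close> and \<open>r\<close> act alike on \<open>R\<close>, then
    \<open>inv r \<otimes> g\<close> centralizes \<open>R\<close> and so lies in \<open>R\<close>.
    Together with the growth of normalizers this makes Aut_S(R) strictly larger than Inn(R).\<close>
  have in_Inn: "g \<in> R" if g: "g \<in> normalizer S R" "restrict (conjugation S g) R \<in> ?N" for g
  proof -
    obtain r where r: "r \<in> R" "restrict (conjugation S g) R = restrict (conjugation S r) R"
      using g(2) unfolding Inn_subgroup_eq[OF R(1)] by blast
    have gS: "g \<in> carrier S" using g(1) subgroup.mem_carrier[OF normalizer_subgroup[OF R(1)]] by blast
    have rS: "r \<in> carrier S" using r(1) subgroup.mem_carrier[OF R(1)] by blast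
    have "inv r \<otimes> g \<otimes> x = x \<otimes> (inv r \<otimes> g)" if x: "x \<in> R" for x
    proof -
      have xS: "x \<in> carrier S" using x subgroup.mem_carrier[OF R(1)] by blast
      have "conjugation S g x = conjugation S r x"
        using fun_cong[OF r(2), of x] x by simp
      then have "conjugation S (inv r \<otimes> g) x = x"
        using gS rS xS by (simp flip: conjugation_comp)
      then have "inv r \<otimes> g \<otimes> x \<otimes> inv (inv r \<otimes> g) \<otimes> (inv r \<otimes> g) = x \<otimes> (inv r \<otimes> g)"
        by (simp add: conjugation_def)
      then show ?thesis using gS rS xS by (simp add: m_assoc)
    qed
    then have "inv r \<otimes> g \<in> R" using C gS rS by (auto simp: centralizer_def)
    then have "r \<otimes> (inv r \<otimes> g) \<in> R" using r(1) subgroup.m_closed[OF R(1)] by blast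
    then show ?thesis using gS rS by (simp flip: m_assoc)
  qed
  obtain g where g: "g \<in> normalizer S R" "g \<notin> R" using RN by blast
  have "restrict (conjugation S g) R \<in> ?T" using g Hom_conj_iff[OF R(1)] by blast
  then have NTs: "?N \<subset> ?T" using NT in_Inn g by blast
  obtain n where n: "card ?N = p ^ n" using Inn_card_p[OF R(1)] .
  have sylH: "Sylow_subgroup p (?A\<lparr>carrier := ?H\<rparr>) ?T"
    by (rule A.Sylow_subgroup_mono[OF prime_p syl H TH])
  interpret AH: finite_group "?A\<lparr>carrier := ?H\<rparr>" by (rule A.finite_group_subgroup[OF H])
  note N = Inn_normal_Aut_fus[OF R(1)]
  have HF: "x \<in> F R R" if "x \<in> ?H" for x using that by simp
  have conjH: "conjugation (?A\<lparr>carrier := ?H\<rparr>) x y = conjugation ?A x y" if "x \<in> ?H" for x y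
    using A.m_inv_consistent[OF H that] by (simp add: conjugation_def)
  \<comment> \<open>Sylow conjugacy is applied inside \<open>?H\<close>, so that the conjugating
    element itself preserves \<open>u\<close>.\<close>
  have into_T: "\<exists>h \<in> ?H. conjugation ?A h ` K \<subseteq> ?T"
    if K: "subgroup K ?A" "card K = p ^ k" "K \<subseteq> ?H" for K k
  proof -
    have "subgroup K (?A\<lparr>carrier := ?H\<rparr>)" by (rule A.subgroup_incl[OF K(1) H K(3)])
    then obtain h where h: "h \<in> ?H" "conjugation (?A\<lparr>carrier := ?H\<rparr>) h ` K \<subseteq> ?T"
      using AH.sylow_conjugate[OF prime_p sylH _ K(2)] by auto
    then show ?thesis using conjH by auto
  qed
  have "strongly_embedded p (?A Mod ?N) ((\<lambda>h. ?N #>\<^bsub>?A\<^esub> h) ` ?H)"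
  proof (rule A.strongly_embedded_Mod[OF prime_p N n H _ _ T TH NTs cT])
    show "?N \<subseteq> ?H" using NT TH by (rule subset_trans)
    show "?H \<noteq> carrier ?A" using ne by (simp add: simps)
    fix x K k
    assume x: "x \<in> carrier ?A - ?H" and K: "subgroup K ?A" "card K = p ^ k" "\<not> K \<subseteq> ?N" "K \<subseteq> ?H"
      and Kx: "conjugation ?A (inv\<^bsub>?A\<^esub> x) ` K \<subseteq> ?H"
    have xA: "x \<in> carrier ?A" using x by blast
    then have ixA: "inv\<^bsub>?A\<^esub> x \<in> carrier ?A" by simp
    obtain h where h: "h \<in> ?H" "conjugation ?A h ` K \<subseteq> ?T" using into_T[OF K(1,2,4)] by blast
    have "card (conjugation ?A (inv\<^bsub>?A\<^esub> x) ` K) = p ^ k"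
      using card_image[OF A.conjugation_inj_on[OF ixA subgroup.subset[OF K(1)]]] K(2) by simp
    then obtain h' where h': "h' \<in> ?H"
      "conjugation ?A h' ` conjugation ?A (inv\<^bsub>?A\<^esub> x) ` K \<subseteq> ?T"
      using into_T[OF A.subgroup_conjugation[OF K(1) ixA] _ Kx] by blast
    have hA: "h \<in> carrier ?A" "h' \<in> carrier ?A" using h(1) h'(1) by (simp_all add: simps)
    \<comment> \<open>By this choice \<beta> carries the conjugate of \<open>y\<close> by
      \<open>h\<close> to the conjugate by \<open>h'\<close> of \<open>y\<close> moved by the
      inverse of \<open>x\<close>; both lie in Aut_S(R).\<close>
    let ?\<beta> = "h' \<otimes>\<^bsub>?A\<^esub> inv\<^bsub>?A\<^esub> x \<otimes>\<^bsub>?A\<^esub> inv\<^bsub>?A\<^esub> h"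
    have \<beta>A: "?\<beta> \<in> carrier ?A" using hA xA by simp
    then have \<beta>: "?\<beta> \<in> F R R" by (simp add: simps)
    obtain y where y: "y \<in> K" "y \<notin> ?N" using K(3) by blast
    have yA: "y \<in> carrier ?A" using y(1) subgroup.mem_carrier[OF K(1)] by blast
    obtain g where g: "g \<in> normalizer S R" "conjugation ?A h y = restrict (conjugation S g) R"
      using h(2) y(1) Hom_conj_iff[OF R(1)] by blast
    \<comment> \<open>Inn(R) is normal, so conjugation by \<open>h\<close> keeps \<open>y\<close>
      outside it.\<close>
    have "g \<notin> R"
    proof
      assume "g \<in> R"
      then have "conjugation ?A h y \<in> ?N" unfolding Inn_subgroup_eq[OF R(1)] g(2) by blast
      then have "conjugation ?A (inv\<^bsub>?A\<^esub> h) (conjugation ?A h y) \<in> ?N"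
        using normal.inv_op_closed2[OF N] A.inv_closed[OF hA(1)]
        by (simp add: conjugation_def[of ?A "inv\<^bsub>?A\<^esub> h"])
      then show False using hA(1) yA y(2) by simp
    qed
    have "conjugation ?A ?\<beta> (conjugation ?A h y)
        = conjugation ?A h' (conjugation ?A (inv\<^bsub>?A\<^esub> x) y)"
      using hA xA yA by (simp add: A.conjugation_comp A.m_assoc)
    then have "conjugation ?A ?\<beta> (restrict (conjugation S g) R) \<in> ?T"
      using h'(2) y(1) unfolding g(2)[symmetric] by auto
    then have "g \<in> N_ext S R R ?\<beta>" by (rule Aut_fus_conjugation_Hom_conj[OF R(1) \<beta> g(1)])
    then have "preserves S u R ?\<beta>"
      using preserves_receptive_aut[OF IH R(1,3) \<beta>] \<open>g \<notin> R\<close> by blast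
    then have \<beta>H: "?\<beta> \<in> ?H" using \<beta> by simp
    \<comment> \<open>Solving the definition of \<beta> for \<open>x\<close> writes it through
      \<beta>, \<open>h\<close> and \<open>h'\<close>, all in \<open>?H\<close>, against the choice
      of \<open>x\<close>.\<close>
    have "inv\<^bsub>?A\<^esub> (inv\<^bsub>?A\<^esub> h' \<otimes>\<^bsub>?A\<^esub> ?\<beta> \<otimes>\<^bsub>?A\<^esub> h) \<in> ?H"
      using subgroup.m_closed[OF H] subgroup.m_inv_closed[OF H] h(1) h'(1) \<beta>H by meson
    moreover have "inv\<^bsub>?A\<^esub> h' \<otimes>\<^bsub>?A\<^esub> ?\<beta> \<otimes>\<^bsub>?A\<^esub> h = inv\<^bsub>?A\<^esub> x"
    proof -
      have "inv\<^bsub>?A\<^esub> h' \<otimes>\<^bsub>?A\<^esub> ?\<beta> = inv\<^bsub>?A\<^esub> x \<otimes>\<^bsub>?A\<^esub> inv\<^bsub>?A\<^esub> h"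
        using hA xA by (simp add: A.m_assoc A.inv_solve_left')
      then show ?thesis using hA xA by (simp add: A.m_assoc)
    qed
    ultimately show False using x by simp
  qed
  moreover have "Out_fus S F R = ?A Mod ?N"
    by (simp add: Out_fus_def Out_of_def Aut_fus_def)
  ultimately show ?thesis by auto
qed

text \<open>The Alperin--Goldschmidt fusion theorem, in terms of invariants.\<close>

theorem preserves_fusion:
  assumes "subgroup P S" "subgroup Q S" "f \<in> Iso_fus F P Q"
  shows "preserves S u P f"
  using assms
proof (induction "card (carrier S) - card P" arbitrary: P Q f rule: less_induct)
  case less
  note P = less.prems(1) and Q = less.prems(2) and f = less.prems(3)
  have cPQ: "card P = card Q" using fus_conj_card[OF P Q] f by (auto simp: fus_conj_def)
  have IH: "preserves_above (card P)"
    unfolding preserves_above_def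
  proof (intro allI impI)
    fix N M h
    assume N: "subgroup N S \<and> subgroup M S \<and> card P < card N \<and> h \<in> Iso_fus F N M"
    then have "card N \<le> card (carrier S)"
      using card_mono[OF finite_carrier subgroup.subset] by blast
    then have "card (carrier S) - card N < card (carrier S) - card P" using N by linarith
    then show "preserves S u N h" using less.hyps N by blast
  qed
  have whole: "M = carrier S" if "subgroup M S" "card M = card (carrier S)" for M
    using card_subset_eq[OF finite_carrier subgroup.subset[OF that(1)] that(2)] .
  show ?case
  proof (cases "P = carrier S")
    case True
    then have "Q = carrier S" using whole[OF Q] cPQ by simp
    then show ?thesis using invariant[OF P] True Iso_F[OF f] by simp
  next
    case False
    then have Qne: "Q \<noteq> carrier S" using whole[OF P] cPQ by auto
    \<comment> \<open>\<open>R\<close> is a common target for \<open>P\<close> and \<open>Q\<close>.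
      The isomorphisms \<open>k\<close> and \<open>l\<close> to it extend to normalizers, which are
      strictly larger, so induction covers them and only an automorphism of \<open>R\<close> is
      left.\<close>
    obtain R where R: "subgroup R S" "fus_conj F P R" "fully_automized p S F R" "receptive S F R"
      using saturated[OF P] by blast
    have cR: "card P = card R" by (rule fus_conj_card[OF P R(1,2)])
    have Rne: "R \<noteq> carrier S" using whole[OF P] cR False by auto
    have cQR: "fus_conj F Q R"
    proof -
      obtain f' where f': "f' \<in> Iso_fus F Q P" using Iso_inverse[OF P Q f] .
      obtain k where "k \<in> Iso_fus F P R" using R(2) by (auto simp: fus_conj_def)
      then show ?thesis using Iso_compose[OF Q P R(1) f'] by (auto simp: fus_conj_def)
    qed
    obtain k hk where k: "k \<in> Iso_fus F P R" and hk: "hk \<in> F (normalizer S P) (carrier S)"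
      "\<And>x. x \<in> P \<Longrightarrow> hk x = k x"
      using extend_to_normalizer[OF R(1,3,4) P R(2)] by metis
    obtain l hl where l: "l \<in> Iso_fus F Q R" and hl: "hl \<in> F (normalizer S Q) (carrier S)"
      "\<And>x. x \<in> Q \<Longrightarrow> hl x = l x"
      using extend_to_normalizer[OF R(1,3,4) Q cQR] by metis
    have pk: "preserves S u P k"
      by (rule preserves_extension[OF IH normalizer_subgroup[OF P] normalizer_subset[OF P False] hk])
    have pl: "preserves S u Q l"
      by (rule preserves_extension[OF IH[unfolded cPQ] normalizer_subgroup[OF Q]
            normalizer_subset[OF Q Qne] hl])
    obtain k' where k': "k' \<in> Iso_fus F R P" "\<And>x. x \<in> P \<Longrightarrow> k' (k x) = x"
      using Iso_inverse[OF P R(1) k] by metis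
    let ?\<alpha> = "compose R l (compose R f k')"
    have \<alpha>: "?\<alpha> \<in> F R R"
      by (rule Iso_F[OF Iso_compose[OF R(1) Q R(1) Iso_compose[OF R(1) P Q k'(1) f] l]])
    have \<alpha>k: "?\<alpha> (k x) = l (f x)" if "x \<in> P" for x
      using that k'(2) F_funcset[OF P R(1) Iso_F[OF k]] by (simp add: compose_eq)
    have p\<alpha>: "preserves S u R ?\<alpha>"
    proof (cases "centralizer S R \<subseteq> R")
      case False
      then obtain c where c: "c \<in> centralizer S R" "c \<notin> R" by blast
      \<comment> \<open>Conjugation by \<open>c\<close> is trivial on \<open>R\<close>, so
        \<open>\<one>\<close> is an intertwining element and the automorphism extends beyond
        \<open>R\<close>.\<close>
      have "?\<alpha> (conjugation S c y) = conjugation S \<one> (?\<alpha> y)" if y: "y \<in> R" for y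
      proof -
        have "?\<alpha> y \<in> carrier S"
          using F_funcset[OF R(1) R(1) \<alpha> y] subgroup.mem_carrier[OF R(1)] by blast
        then have "conjugation S \<one> (?\<alpha> y) = ?\<alpha> y" by (simp add: conjugation_def)
        then show ?thesis using centralizer_normalizer(2)[OF R(1) c(1) y] by simp
      qed
      then have "c \<in> N_ext S R R ?\<alpha>"
        unfolding N_ext_iff[OF R(1) R(1) F_self_iso[OF R(1) \<alpha>]]
        using centralizer_normalizer(1)[OF R(1) c(1)] one_closed by blast
      then show ?thesis
        using preserves_receptive_aut[OF IH[unfolded cR] R(1,4) \<alpha>] c(2) by blast
    next
      case True
      show ?thesis
      proof (cases "{\<alpha> \<in> F R R. preserves S u R \<alpha>} = F R R")
        case all: True
        then show ?thesis using \<alpha> by blast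
      next
        case some: False
        \<comment> \<open>An automorphism failing to preserve \<open>u\<close> would make
          \<open>R\<close> essential, where preservation is assumed.\<close>
        have "essential p S F R"
          unfolding essential_def
          using R(1) fus_centricI[OF R(1,3,4) True] fully_normalizedI[OF R(1,3,4)]
            strongly_embedded_preserving[OF IH[unfolded cR] R(1,3,4) Rne True some] by blast
        then show ?thesis using invariant[OF R(1) _ \<alpha>] by blast
      qed
    qed
    show ?thesis
      unfolding preserves_def
    proof (intro allI impI)
      fix A assume A: "subgroup A S \<and> A \<subseteq> P"
      have fA: "subgroup (f ` A) S" "f ` A \<subseteq> Q"
        using F_image_subgroup[OF P Q Iso_F[OF f]] F_funcset[OF P Q Iso_F[OF f]] A by blast+
      have kA: "subgroup (k ` A) S" "k ` A \<subseteq> R"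
        using F_image_subgroup[OF P R(1) Iso_F[OF k]] F_funcset[OF P R(1) Iso_F[OF k]] A by blast+
      have "u (f ` A) = u (l ` f ` A)" using pl fA by (simp add: preserves_def)
      also have "l ` f ` A = (\<lambda>x. ?\<alpha> (k x)) ` A"
        unfolding image_image using A \<alpha>k by (intro image_cong) auto
      also have "\<dots> = ?\<alpha> ` k ` A" by (rule image_image[symmetric])
      also have "u \<dots> = u (k ` A)" using p\<alpha> kA by (simp add: preserves_def)
      also have "\<dots> = u A" using pk A by (simp add: preserves_def)
      finally show "u (f ` A) = u A" .
    qed
  qed
qed

end

section \<open>The kernels of the maps \<open>d\<close>\<close>

text \<open>In \<open>d_target\<close> this set is the one divided out; being a subgroup, it equals
  the coset of an element exactly when it contains that element.\<close>

lemma (in finite_group) fixed_units_subgroup: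
  assumes A: "A \<subseteq> auto G"
  shows "subgroup (fixed_units G (carrier (Out_of G A))) (units_of (burnside_ring G))"
proof -
  interpret U: group "units_of (burnside_ring G)" by (rule group_burnside_units)
  have img: "subgroup (\<alpha> ` H) G" if "\<alpha> \<in> A" "subgroup H G" for \<alpha> H
    using auto_image_subgroup(1) that A by blast
  show ?thesis
    unfolding fixed_units_eq[OF A]
  proof (rule U.subgroupI, goal_cases)
    case 1
    show ?case by (auto simp: units_of_def)
  next
    case 2
    have "\<one>\<^bsub>burnside_ring G\<^esub> \<in> Units (burnside_ring G)"
      by (simp add: burnside_units mark_one)
    then show ?case using img mark_one(2) by fastforce
  next
    case (3 a)
    then have "a \<in> carrier (burnside_ring G)" "\<And>H. subgroup H G \<Longrightarrow> mark H a \<in> {1, - 1}"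
      unfolding burnside_units by blast+
    then have "a \<otimes>\<^bsub>burnside_ring G\<^esub> a = \<one>\<^bsub>burnside_ring G\<^esub>" by (rule square_unit)
    then have "inv\<^bsub>units_of (burnside_ring G)\<^esub> a = a"
      using 3 by (intro U.inv_equality) (auto simp: units_of_def)
    then show ?case using 3 by simp
  next
    case (4 a b)
    then have ab: "a \<in> carrier (burnside_ring G)" "b \<in> carrier (burnside_ring G)"
      by (auto simp: burnside_units)
    have "a \<otimes>\<^bsub>units_of (burnside_ring G)\<^esub> b \<in> Units (burnside_ring G)"
      using U.m_closed[of a b] 4 by (simp add: units_of_def)
    then show ?case using 4 img by (simp add: units_of_mult mark_mult[OF ab])
  qed
qed

context fusion_system
begin

text \<open>The identity of \<open>d_target\<close> is the subgroup of fixed units itself, so the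
  kernel consists of the units whose restriction lies in it. Restriction keeps the marks at
  subgroups of \<open>P\<close>.\<close>

lemma ker_d_eq:
  assumes P: "subgroup P S"
  shows "ker_d S F P = {u \<in> Units (burnside_ring S).
    \<forall>\<alpha> \<in> F P P. \<forall>A. subgroup A S \<and> A \<subseteq> P \<longrightarrow> mark (\<alpha> ` A) u = mark A u}"
proof -
  let ?SP = "S\<lparr>carrier := P\<rparr>"
  interpret SP: finite_group ?SP by (rule finite_group_subgroup[OF P])
  interpret U: group "units_of (burnside_ring ?SP)" by (rule SP.group_burnside_units)
  let ?W = "fixed_units ?SP (carrier (Out_fus S F P))"
  have W: "subgroup ?W (units_of (burnside_ring ?SP))"
    unfolding Out_fus_def by (rule SP.fixed_units_subgroup[OF F_auto[OF P]])
  have sub: "subgroup A ?SP \<longleftrightarrow> subgroup A S \<and> A \<subseteq> P" for A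
    using incl_subgroup[OF P] subgroup_incl[OF _ P] subgroup.subset[of A ?SP] by auto
  have "d_map S F P u = \<one>\<^bsub>d_target S F P\<^esub> \<longleftrightarrow>
      (\<forall>\<alpha> \<in> F P P. \<forall>A. subgroup A S \<and> A \<subseteq> P \<longrightarrow> mark (\<alpha> ` A) u = mark A u)"
    if u: "u \<in> Units (burnside_ring S)" for u
  proof -
    have uc: "u \<in> carrier (burnside_ring S)" using u by (simp add: burnside_units)
    note res = burnside_res_mark[OF P uc]
    have resU: "burnside_res S P u \<in> Units (burnside_ring ?SP)"
      unfolding SP.burnside_units using res u unfolding burnside_units sub by auto
    have "d_map S F P u = \<one>\<^bsub>d_target S F P\<^esub> \<longleftrightarrow> burnside_res S P u \<in> ?W"
      using U.coset_join1[OF _ _ W] U.coset_join2[OF _ W] resU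
      by (auto simp: d_map_def d_target_def Let_def units_of_def)
    also have "\<dots> \<longleftrightarrow> (\<forall>\<alpha> \<in> F P P. \<forall>A. subgroup A S \<and> A \<subseteq> P \<longrightarrow>
        mark (\<alpha> ` A) (burnside_res S P u) = mark A (burnside_res S P u))"
      unfolding Out_fus_def SP.fixed_units_eq[OF F_auto[OF P]] sub using resU by blast
    also have "\<dots> \<longleftrightarrow> (\<forall>\<alpha> \<in> F P P. \<forall>A. subgroup A S \<and> A \<subseteq> P \<longrightarrow>
        mark (\<alpha> ` A) u = mark A u)"
    proof (intro ball_cong refl iff_allI imp_cong)
      fix \<alpha> A assume \<alpha>: "\<alpha> \<in> F P P" and A: "subgroup A S \<and> A \<subseteq> P"
      have "subgroup (\<alpha> ` A) S" "\<alpha> ` A \<subseteq> P"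
        using F_image_subgroup[OF P P \<alpha>] F_funcset[OF P P \<alpha>] A by blast+
      then show "(mark (\<alpha> ` A) (burnside_res S P u) = mark A (burnside_res S P u)) =
          (mark (\<alpha> ` A) u = mark A u)" using res(2) A by simp
    qed
    finally show ?thesis .
  qed
  then show ?thesis by (auto simp: kernel_def d_source_def units_of_def)
qed

text \<open>A unit of \<open>burnside_ring S\<close> is its own inverse, so its inverse lies in the
  subring as soon as it does.\<close>

lemma Units_burnside_ring_fus:
  "Units (burnside_ring_fus S F) = {u \<in> Units (burnside_ring S).
     \<forall>P Q. subgroup P S \<and> subgroup Q S \<and> fus_conj F P Q \<longrightarrow> mark P u = mark Q u}"
  (is "_ = ?R")
proof (intro equalityI subsetI)
  fix u assume "u \<in> Units (burnside_ring_fus S F)"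
  then show "u \<in> ?R" unfolding Units_def burnside_ring_fus_def by simp blast
next
  fix u assume u: "u \<in> ?R"
  then have c: "u \<in> carrier (burnside_ring_fus S F)"
    by (simp add: burnside_ring_fus_def burnside_units)
  have "u \<otimes>\<^bsub>burnside_ring S\<^esub> u = \<one>\<^bsub>burnside_ring S\<^esub>"
    using u unfolding burnside_units by (intro square_unit) blast+
  then have "u \<otimes>\<^bsub>burnside_ring_fus S F\<^esub> u = \<one>\<^bsub>burnside_ring_fus S F\<^esub>"
    by (simp add: burnside_ring_fus_def)
  then show "u \<in> Units (burnside_ring_fus S F)" using c unfolding Units_def by blast
qed

end

theorem theorem6p1:
  fixes p :: nat and S :: "('a, 'm) monoid_scheme" and F :: "'a fusion"
  assumes "saturated_fusion_system p S F"
  shows "Units (burnside_ring_fus S F) = (\<Inter>P \<in> {P. subgroup P S}. ker_d S F P) \<and>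
    Units (burnside_ring_fus S F) =
      (\<Inter>R \<in> {R. subgroup R S \<and> (R = carrier S \<or> essential p S F R)}. ker_d S F R)"
proof -
  interpret saturated_fusion_system p S F by fact
  let ?U = "Units (burnside_ring_fus S F)"
  let ?E = "{R. subgroup R S \<and> (R = carrier S \<or> essential p S F R)}"
  have "u \<in> ker_d S F P" if u: "u \<in> ?U" and P: "subgroup P S" for u P
    unfolding ker_d_eq[OF P]
  proof (intro CollectI conjI ballI allI impI)
    show "u \<in> Units (burnside_ring S)" using u by (simp add: Units_burnside_ring_fus)
    fix \<alpha> A assume \<alpha>: "\<alpha> \<in> F P P" and A: "subgroup A S \<and> A \<subseteq> P"
    have r: "restrict \<alpha> A \<in> F A P" using F_restrict[OF P P \<alpha>] A by blast
    have "restrict \<alpha> A ` A = \<alpha> ` A" by simp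
    then have "\<alpha> ` A = restrict \<alpha> A ` A" ..
    then have "subgroup (\<alpha> ` A) S" "fus_conj F A (\<alpha> ` A)"
      using F_onto_image[OF _ P r] A by (auto simp: fus_conj_def)
    then show "mark (\<alpha> ` A) u = mark A u" using u A by (auto simp: Units_burnside_ring_fus)
  qed
  then have 1: "?U \<subseteq> (\<Inter>P \<in> {P. subgroup P S}. ker_d S F P)" by blast
  \<comment> \<open>The second family of subgroups is part of the first; with 1 and 3 this closes a
    cycle of inclusions that yields both equalities.\<close>
  have 2: "(\<Inter>P \<in> {P. subgroup P S}. ker_d S F P) \<subseteq> (\<Inter>R \<in> ?E. ker_d S F R)" by blast
  have "u \<in> ?U" if u: "u \<in> (\<Inter>R \<in> ?E. ker_d S F R)" for u
  proof -
    have E: "u \<in> ker_d S F R" if "subgroup R S" "R = carrier S \<or> essential p S F R" for R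
      using u that by blast
    have "essential_invariant p S F (\<lambda>A. mark A u)"
    proof (unfold_locales, goal_cases)
      case (1 R \<alpha>)
      then show ?case using E[OF 1(1,2)] unfolding ker_d_eq[OF 1(1)] preserves_def by blast
    qed
    then interpret essential_invariant p S F "\<lambda>A. mark A u" .
    have "mark P u = mark Q u" if PQ: "subgroup P S" "subgroup Q S" "fus_conj F P Q" for P Q
    proof -
      obtain f where f: "f \<in> Iso_fus F P Q" using PQ(3) by (auto simp: fus_conj_def)
      show ?thesis
        using preserves_fusion[OF PQ(1,2) f] Iso_image[OF PQ(1,2) f] PQ(1)
        by (auto simp: preserves_def)
    qed
    moreover have "u \<in> Units (burnside_ring S)"
      using E[OF subgroup_self] unfolding ker_d_eq[OF subgroup_self] by blast
    ultimately show ?thesis by (auto simp: Units_burnside_ring_fus)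
  qed
  then have 3: "(\<Inter>R \<in> ?E. ker_d S F R) \<subseteq> ?U" by blast
  show ?thesis
    by (rule conjI[OF equalityI[OF 1 subset_trans[OF 2 3]] equalityI[OF subset_trans[OF 1 2] 3]])
qed

end
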